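(* Let $f$ be any one of the following 13 degree-based topological indices: ABSC, AG, AG-GA, Extended, GA, GouravaSC, Harmonic, Randić, Sombor, rSombor, SumConn, rSumConn, lnZagreb1. Then the set of chemical graphs that are extremal for $f$ is exactly $F_1\cup F_2$.
   Context: All graphs are finite, simple and undirected. A chemical graph is a connected graph of order (number of vertices) $n\ge 7$, size (number of edges) $m\le \frac{3n-3}{2}$ and maximum degree at most $3$. For such a graph, $x_{ij}$ ($i\le j$) denotes the number of $(i,j)$-edges, i.e. edges whose endpoints have degrees $i$ and $j$ (necessarily $x_{11}=0$). A degree-based topological index is a function of the form $f(G)=c_{12}x_{12}+c_{13}x_{13}+c_{22}x_{22}+c_{23}x_{23}+c_{33}x_{33}$ with real coefficients $c_{ij}$. A chemical graph $G$ is extremal for $f$ if it maximizes $f$ or minimizes $f$ over all chemical graphs of the same order and size as $G$. The indices are given by the following coefficients $c_{ij}$: - ABSC: $\sqrt{\frac{i+j-2}{i+j}}$; - AG: $\frac{i+j}{2\sqrt{ij}}$; - AG-GA: $\frac{i+j}{2\sqrt{ij}}-\frac{2\sqrt{ij}}{i+j}$; - Extended: $\frac12\left(\frac ij+\frac ji\right)$; - GA: $\frac{2\sqrt{ij}}{i+j}$; - GouravaSC: $\frac{1}{\sqrt{i+j+ij}}$; - Harmonic: $\frac{2}{i+j}$; - Randić: $\frac{1}{\sqrt{ij}}$; - Sombor: $\sqrt{i^2+j^2}$; - rSombor: $\sqrt{(i-1)^2+(j-1)^2}$; - SumConn: $\frac{1}{\sqrt{i+j}}$; - rSumConn: $\sqrt{i+j}$;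 - lnZagreb1: $\ln(i+j)$. $F_1$ is the set of chemical graphs (of order $n$ and size $m$) with $(x_{12},x_{13},x_{22},x_{23},x_{33})$ equal to - $\left(0,\frac{3n-2m}{2},0,0,\frac{4m-3n}{2}\right)$ if $n$ is even; - $\left(0,\frac{3n-2m-1}{2},0,2,\frac{4m-3n-3}{2}\right)$ if $n$ is odd. $F_2$ is the set of chemical graphs (of order $n$ and size $m$) with $(x_{12},x_{13},x_{22},x_{23},x_{33})$ equal to - $(2,0,m-2,0,0)$ if $m=n-1$; - $(0,0,m,0,0)$ if $m=n$; - $(0,0,m-5,4,1)$ if $m=n+1$; - $(0,0,3n-2m-1,2,3m-3n-1)$ if $n+1<m\le\frac{3n-3}{2}$. *)

theory Defs
  imports Complex_Main
begin

record 'a ugraph =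
  verts :: "'a set"
  edges :: "'a set set"

definition simple_graph :: "'a ugraph \<Rightarrow> bool" where
  "simple_graph G \<longleftrightarrow>
     finite (verts G) \<and> (\<forall>e \<in> edges G. e \<subseteq> verts G \<and> card e = 2)"

definition graph_order :: "'a ugraph \<Rightarrow> nat" where
  "graph_order G = card (verts G)"

definition graph_size :: "'a ugraph \<Rightarrow> nat" where
  "graph_size G = card (edges G)"

definition vdegree :: "'a ugraph \<Rightarrow> 'a \<Rightarrow> nat" where
  "vdegree G v = card {e \<in> edges G. v \<in> e}"

definition connected_graph :: "'a ugraph \<Rightarrow> bool" where
  "connected_graph G \<longleftrightarrow>
     verts G \<noteq> {} \<and>
     (\<forall>u \<in> verts G. \<forall>v \<in> verts G. (u, v) \<in> {(a, b). {a, b} \<in> edges G}\<^sup>*)"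

definition chemical_graph :: "'a ugraph \<Rightarrow> bool" where
  "chemical_graph G \<longleftrightarrow>
     simple_graph G \<and> connected_graph G \<and> graph_order G \<ge> 7 \<and>
     real (graph_size G) \<le> (3 * real (graph_order G) - 3) / 2 \<and>
     (\<forall>v \<in> verts G. vdegree G v \<le> 3)"

definition edge_count :: "'a ugraph \<Rightarrow> nat \<Rightarrow> nat \<Rightarrow> nat" where
  "edge_count G i j =
     card {e \<in> edges G. \<exists>u v. e = {u, v} \<and> vdegree G u = i \<and> vdegree G v = j}"

definition degree_based_index :: "(nat \<Rightarrow> nat \<Rightarrow> real) \<Rightarrow> 'a ugraph \<Rightarrow> real" where
  "degree_based_index c G =
     c 1 2 * real (edge_count G 1 2) + c 1 3 * real (edge_count G 1 3) +
     c 2 2 * real (edge_count G 2 2) + c 2 3 * real (edge_count G 2 3) +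
     c 3 3 * real (edge_count G 3 3)"

text \<open>
  The graphs compared with \<open>G\<close> have vertices in the same type \<open>'a\<close>. This loses nothing:
  a graph of the same order as \<open>G\<close> has an isomorphic copy with vertex set \<open>verts G\<close>, and
  order, size and degree-based indices are invariant under isomorphism.
\<close>

definition extremal :: "('a ugraph \<Rightarrow> real) \<Rightarrow> 'a ugraph \<Rightarrow> bool" where
  "extremal f G \<longleftrightarrow>
     chemical_graph G \<and>
     ((\<forall>H. chemical_graph H \<and> graph_order H = graph_order G \<and> graph_size H = graph_size G \<longrightarrow> f H \<le> f G) \<or>
      (\<forall>H. chemical_graph H \<and> graph_order H = graph_order G \<and> graph_size H = graph_size G \<longrightarrow> f G \<le> f H))"

datatype topological_index =
    ABSC | AG | AG_GA | Extended | GA | GouravaSC | Harmonic | Randic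
  | Sombor | RSombor | SumConn | RSumConn | LnZagreb1

fun coefficient :: "topological_index \<Rightarrow> real \<Rightarrow> real \<Rightarrow> real" where
  "coefficient ABSC i j = sqrt ((i + j - 2) / (i + j))"
| "coefficient AG i j = (i + j) / (2 * sqrt (i * j))"
| "coefficient AG_GA i j = (i + j) / (2 * sqrt (i * j)) - 2 * sqrt (i * j) / (i + j)"
| "coefficient Extended i j = (i / j + j / i) / 2"
| "coefficient GA i j = 2 * sqrt (i * j) / (i + j)"
| "coefficient GouravaSC i j = 1 / sqrt (i + j + i * j)"
| "coefficient Harmonic i j = 2 / (i + j)"
| "coefficient Randic i j = 1 / sqrt (i * j)"
| "coefficient Sombor i j = sqrt (i\<^sup>2 + j\<^sup>2)"
| "coefficient RSombor i j = sqrt ((i - 1)\<^sup>2 + (j - 1)\<^sup>2)"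
| "coefficient SumConn i j = 1 / sqrt (i + j)"
| "coefficient RSumConn i j = sqrt (i + j)"
| "coefficient LnZagreb1 i j = ln (i + j)"

definition index_value :: "topological_index \<Rightarrow> 'a ugraph \<Rightarrow> real" where
  "index_value t = degree_based_index (\<lambda>i j. coefficient t (real i) (real j))"

definition edge_counts :: "'a ugraph \<Rightarrow> real \<times> real \<times> real \<times> real \<times> real" where
  "edge_counts G =
     (real (edge_count G 1 2), real (edge_count G 1 3), real (edge_count G 2 2),
      real (edge_count G 2 3), real (edge_count G 3 3))"

definition F1 :: "'a ugraph set" where
  "F1 = {G. chemical_graph G \<and>
     (let n = real (graph_order G); m = real (graph_size G) in
        (even (graph_order G) \<and>
           edge_counts G = (0, (3 * n - 2 * m) / 2, 0, 0, (4 * m - 3 * n) / 2)) \<or>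
        (odd (graph_order G) \<and>
           edge_counts G = (0, (3 * n - 2 * m - 1) / 2, 0, 2, (4 * m - 3 * n - 3) / 2)))}"

definition F2 :: "'a ugraph set" where
  "F2 = {G. chemical_graph G \<and>
     (let n = real (graph_order G); m = real (graph_size G) in
        (m = n - 1 \<and> edge_counts G = (2, 0, m - 2, 0, 0)) \<or>
        (m = n \<and> edge_counts G = (0, 0, m, 0, 0)) \<or>
        (m = n + 1 \<and> edge_counts G = (0, 0, m - 5, 4, 1)) \<or>
        (n + 1 < m \<and> m \<le> (3 * n - 3) / 2 \<and>
           edge_counts G = (0, 0, 3 * n - 2 * m - 1, 2, 3 * m - 3 * n - 1)))}"

end

theory Submission
  imports Defs
begin

text \<open>
  Counting vertices by degree gives two linear relations between \<open>n\<close>, \<open>m\<close> and the five edge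
  counts \<open>x\<^sub>1\<^sub>2, x\<^sub>1\<^sub>3, x\<^sub>2\<^sub>2, x\<^sub>2\<^sub>3, x\<^sub>3\<^sub>3\<close>, so for fixed \<open>n\<close> and \<open>m\<close> an index depends on three of
  them only. Put
  \<open>p = c\<^sub>1\<^sub>2 - 5/2 c\<^sub>2\<^sub>2 + 3/2 c\<^sub>3\<^sub>3\<close>, \<open>q = c\<^sub>1\<^sub>3 - 2 c\<^sub>2\<^sub>2 + c\<^sub>3\<^sub>3\<close> and
  \<open>r = c\<^sub>2\<^sub>3 - 1/2 c\<^sub>2\<^sub>2 - 1/2 c\<^sub>3\<^sub>3\<close>. Up to a term that depends on \<open>n\<close> and \<open>m\<close> alone, the index is

    \<^item> \<open>p x\<^sub>1\<^sub>2 + q x\<^sub>1\<^sub>3 + r x\<^sub>2\<^sub>3\<close> after elimination of \<open>x\<^sub>2\<^sub>2\<close> and \<open>x\<^sub>3\<^sub>3\<close>, and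
    \<^item> \<open>- ((5/4 q - p) x\<^sub>1\<^sub>2 + q/2 x\<^sub>2\<^sub>2 + (q/4 - r) x\<^sub>2\<^sub>3)\<close> after elimination of \<open>x\<^sub>1\<^sub>3\<close> and \<open>x\<^sub>3\<^sub>3\<close>.

  For each of the thirteen indices there is a sign \<open>s\<close> such that \<open>s p\<close>, \<open>s q\<close>, \<open>s r\<close>, written \<open>p\<close>, \<open>q\<close>, \<open>r\<close>
  again, satisfy \<open>0 < r < p < q\<close> and \<open>4 r < q\<close>
  (\<open>index_excess_ordered\<close>). Then \<open>p\<close>, \<open>q\<close>, \<open>r\<close> and the coefficients \<open>5/4 q - p\<close>, \<open>q/2\<close>, \<open>q/4 - r\<close> of the
  second form, which enters negatively, are all positive: one extreme value of the index avoids 12-, 13- and 23-edges as far as possible, the other one avoids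
  12-, 22- and 23-edges.

  How far this is possible is a question of parity and connectedness. For the second form,
  everything is avoided when \<open>n\<close> is even, and an odd \<open>n\<close> forces an odd number of vertices of
  degree 2, the cheapest case being a single one with two neighbours of degree 3
  (\<open>F1_cost_less\<close>). For the first form, vertices of degrees 2 and 3 have to be joined somehow
  if both are present, which costs at least two 23-edges; paths, cycles and the case \<open>m = n + 1\<close>,
  where two vertices of degree 3 span at most one edge, are the exceptions (\<open>F2_cost_less\<close>). The
  inequalities between \<open>p\<close>, \<open>q\<close> and \<open>r\<close> say that no leaf is worth the 23-edges it could save.

  The optimal edge counts are exactly those of \<open>F1\<close> and \<open>F2\<close>. They only bound the extremal graphs
  if they are attained for every order and size, so members of both families are
  constructed from paths and cycles by adding chords and pendant vertices
  (\<open>both_families_occur\<close>).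
\<close>

section \<open>Connected graphs\<close>

lemma edge_endsE:
  assumes "simple_graph G" "e \<in> edges G"
  obtains u v where "e = {u, v}" "u \<noteq> v" "u \<in> verts G" "v \<in> verts G"
  using assms unfolding simple_graph_def by (metis card_2_iff insert_subset)

lemma finite_edges:
  assumes "simple_graph G" shows "finite (edges G)"
proof -
  have "edges G \<subseteq> Pow (verts G)" using assms by (auto simp: simple_graph_def)
  then show ?thesis using assms by (meson finite_Pow_iff finite_subset simple_graph_def)
qed

lemma connected_crossing_edge:
  assumes "connected_graph G" "S \<subseteq> verts G" "S \<noteq> {}" "S \<noteq> verts G"
  obtains u v where "u \<in> S" "v \<notin> S" "{u, v} \<in> edges G"
proof -
  obtain a b where ab: "a \<in> S" "b \<in> verts G" "b \<notin> S" using assms(2-4) by blast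
  then have "(a, b) \<in> {(a, b). {a, b} \<in> edges G}\<^sup>*"
    using assms(1,2) by (auto simp: connected_graph_def)
  then have "b \<in> S \<or> (\<exists>u v. u \<in> S \<and> v \<notin> S \<and> {u, v} \<in> edges G)"
    by (induction rule: rtrancl_induct) (use ab in auto)
  then show thesis using that ab by blast
qed

text \<open>
  A connected vertex set can be grown one vertex at a time, and each new vertex brings along an edge
  that crosses the boundary of the set built so far.
\<close>

lemma connected_order_le_size:
  assumes simple: "simple_graph G" and conn: "connected_graph G"
  shows "graph_order G \<le> graph_size G + 1"
proof -
  have fin: "finite (verts G)" using simple by (simp add: simple_graph_def)
  have fE: "finite (edges G)" using simple by (rule finite_edges)
  \<comment> \<open>\<open>S\<close> is the set after \<open>j\<close> growing steps.\<close>
  have "\<exists>S \<subseteq> verts G. card S = Suc j \<and> j \<le> card {e \<in> edges G. e \<subseteq> S}"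
    if "j < card (verts G)" for j
    using that
  proof (induction j)
    case 0
    obtain v where "v \<in> verts G" using 0 by fastforce
    then show ?case by (intro exI[of _ "{v}"]) auto
  next
    case (Suc j)
    then obtain S where S: "S \<subseteq> verts G" "card S = Suc j" "j \<le> card {e \<in> edges G. e \<subseteq> S}"
      by auto
    have "S \<noteq> {}" "S \<noteq> verts G" using S Suc.prems by auto
    then obtain u v where uv: "u \<in> S" "v \<notin> S" "{u, v} \<in> edges G"
      using connected_crossing_edge[OF conn S(1)] by metis
    have v: "v \<in> verts G" using uv(3) simple by (auto simp: simple_graph_def)
    have finS: "finite S" using S(1) fin finite_subset by blast
    have "card (insert {u, v} {e \<in> edges G. e \<subseteq> S}) \<le> card {e \<in> edges G. e \<subseteq> insert v S}"
      by (rule card_mono) (use uv fE in auto)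
    moreover have "card (insert {u, v} {e \<in> edges G. e \<subseteq> S}) = Suc (card {e \<in> edges G. e \<subseteq> S})"
      using fE uv(2) by (intro card_insert_disjoint) auto
    ultimately show ?case
      using S v uv(2) finS by (intro exI[of _ "insert v S"]) auto
  qed
  moreover have "card (verts G) - 1 < card (verts G)"
    using conn fin by (simp add: connected_graph_def card_gt_0_iff)
  ultimately obtain S where "card (verts G) - 1 \<le> card {e \<in> edges G. e \<subseteq> S}" by blast
  also have "\<dots> \<le> card (edges G)" using fE by (intro card_mono) auto
  finally show ?thesis by (simp add: graph_order_def graph_size_def)
qed

section \<open>Degree classes and edge classes\<close>

definition degree_class :: "'a ugraph \<Rightarrow> nat \<Rightarrow> 'a set" where
  "degree_class G i = {v \<in> verts G. vdegree G v = i}"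

lemma finite_degree_class: "simple_graph G \<Longrightarrow> finite (degree_class G i)"
  by (simp add: degree_class_def simple_graph_def)

text \<open>
  Double counting of the incidences between edges and vertices of degree \<open>i\<close>.
\<close>

lemma degree_class_incidences:
  assumes "simple_graph G"
  shows "i * card (degree_class G i) = (\<Sum>e\<in>edges G. card {v \<in> e. vdegree G v = i})"
proof -
  have "(\<Sum>v\<in>degree_class G i. card {e \<in> edges G. v \<in> e})
      = (\<Sum>e\<in>edges G. card {v \<in> e. vdegree G v = i})"
  proof (rule sum_multicount_gen)
    show "\<forall>e\<in>edges G. card {v \<in> degree_class G i. v \<in> e} = card {v \<in> e. vdegree G v = i}"
    proof
      fix e assume "e \<in> edges G"
      then have "e \<subseteq> verts G" using assms by (auto simp: simple_graph_def)
      then have "{v \<in> degree_class G i. v \<in> e} = {v \<in> e. vdegree G v = i}"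
        by (auto simp: degree_class_def)
      then show "card {v \<in> degree_class G i. v \<in> e} = card {v \<in> e. vdegree G v = i}" by simp
    qed
  qed (use assms finite_edges finite_degree_class in auto)
  moreover have "(\<Sum>v\<in>degree_class G i. card {e \<in> edges G. v \<in> e}) = i * card (degree_class G i)"
    by (simp add: degree_class_def flip: vdegree_def)
  ultimately show ?thesis by simp
qed

definition in_edge_class :: "'a ugraph \<Rightarrow> nat \<Rightarrow> nat \<Rightarrow> 'a set \<Rightarrow> bool" where
  "in_edge_class G i j e \<longleftrightarrow> (\<exists>u v. e = {u, v} \<and> vdegree G u = i \<and> vdegree G v = j)"

lemma in_edge_class_doubleton:
  "in_edge_class G i j {a, b} \<longleftrightarrow>
     vdegree G a = i \<and> vdegree G b = j \<or> vdegree G a = j \<and> vdegree G b = i"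
  unfolding in_edge_class_def by (auto simp: doubleton_eq_iff)

lemma edge_count_eq_sum:
  assumes "simple_graph G"
  shows "edge_count G i j = (\<Sum>e\<in>edges G. of_bool (in_edge_class G i j e))"
  using finite_edges[OF assms]
  by (simp add: edge_count_def Int_def flip: in_edge_class_def)

lemma edge_count_eq_0_iff:
  assumes "simple_graph G"
  shows "edge_count G i j = 0 \<longleftrightarrow>
    (\<forall>u v. {u, v} \<in> edges G \<longrightarrow> \<not> (vdegree G u = i \<and> vdegree G v = j))"
proof -
  have "edge_count G i j = 0 \<longleftrightarrow>
    {e \<in> edges G. \<exists>u v. e = {u, v} \<and> vdegree G u = i \<and> vdegree G v = j} = {}"
    unfolding edge_count_def using finite_edges[OF assms] by (intro card_0_eq) auto
  then show ?thesis by blast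
qed

context
  fixes G :: "'a ugraph"
  assumes chem: "chemical_graph G"
begin

lemma chemical_simple: "simple_graph G" and chemical_connected: "connected_graph G"
  and chemical_order: "7 \<le> graph_order G"
  using chem by (auto simp: chemical_graph_def)

lemma chemical_size: "2 * graph_size G + 3 \<le> 3 * graph_order G"
  using chem by (simp add: chemical_graph_def)

lemma chemical_degree_pos:
  assumes "v \<in> verts G" shows "1 \<le> vdegree G v"
proof -
  have "card {v} \<noteq> card (verts G)" using chemical_order by (simp add: graph_order_def)
  then have "{v} \<noteq> verts G" by metis
  then obtain u where "{v, u} \<in> edges G"
    using connected_crossing_edge[OF chemical_connected, of "{v}"] assms by auto
  then have "{e \<in> edges G. v \<in> e} \<noteq> {}" by blast
  then show ?thesis
    using finite_edges[OF chemical_simple] by (simp add: vdegree_def Suc_le_eq card_gt_0_iff)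
qed

lemma chemical_degree_cases:
  assumes "v \<in> verts G"
  shows "vdegree G v = 1 \<or> vdegree G v = 2 \<or> vdegree G v = 3"
proof -
  have "vdegree G v \<le> 3" using assms chem by (simp add: chemical_graph_def)
  then show ?thesis using chemical_degree_pos[OF assms] by linarith
qed

lemma leaf_unique_neighbour:
  assumes "vdegree G v = 1" "{v, u} \<in> edges G" "{v, w} \<in> edges G"
  shows "u = w"
proof -
  obtain e where "{e \<in> edges G. v \<in> e} = {e}"
    using assms(1) unfolding vdegree_def by (rule card_1_singletonE)
  moreover have "{v, u} \<in> {e \<in> edges G. v \<in> e}" "{v, w} \<in> {e \<in> edges G. v \<in> e}"
    using assms(2,3) by simp_all
  ultimately have "{v, u} = {v, w}" by simp
  then show ?thesis by (simp only: doubleton_eq_iff) blast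
qed

text \<open>
  The two ends of such an edge would form a component of their own.
\<close>

lemma no_leaf_leaf_edge:
  assumes "{u, v} \<in> edges G" "vdegree G u = 1" "vdegree G v = 1"
  shows False
proof -
  have uv: "{u, v} \<subseteq> verts G" using assms(1) chemical_simple by (auto simp: simple_graph_def)
  have "card {u, v} \<le> 2" by (simp add: card_insert_if)
  then have "card {u, v} \<noteq> card (verts G)" using chemical_order unfolding graph_order_def by linarith
  then have "{u, v} \<noteq> verts G" by metis
  then obtain a b where ab: "a \<in> {u, v}" "b \<notin> {u, v}" "{a, b} \<in> edges G"
    using connected_crossing_edge[OF chemical_connected uv] by (metis insert_not_empty)
  have "{v, u} \<in> edges G" using assms(1) by (simp add: insert_commute)
  then have "v = b \<or> u = b"
  proof (cases "a = u")
    case True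
    then show ?thesis
      using leaf_unique_neighbour[OF assms(2) assms(1), of b] ab(3) by simp
  next
    case False
    then have "a = v" using ab(1) by simp
    then show ?thesis
      using leaf_unique_neighbour[OF assms(3) \<open>{v, u} \<in> edges G\<close>, of b] ab(3) by simp
  qed
  then show False using ab(2) by blast
qed

text \<open>
  Every relation is a sum over the edges of a pointwise identity: an edge lies in exactly one of the
  five classes, and its class tells how many of its ends have degree 1, 2 and 3. Together these
  relations express \<open>n\<close> and \<open>m\<close> by the edge counts and carry all the parity arguments.
\<close>

lemma chemical_balance:
  defines "N \<equiv> \<lambda>i. card (degree_class G i)" and "x \<equiv> edge_count G"
  shows "graph_order G = N 1 + N 2 + N 3"
    and "graph_size G = x 1 2 + x 1 3 + x 2 2 + x 2 3 + x 3 3"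
    and "N 1 = x 1 2 + x 1 3"
    and "2 * N 2 = x 1 2 + 2 * x 2 2 + x 2 3"
    and "3 * N 3 = x 1 3 + x 2 3 + 2 * x 3 3"
proof -
  let ?I = "\<lambda>i j e. of_bool (in_edge_class G i j e) :: nat"
  have ends: "?I 1 2 e + ?I 1 3 e + ?I 2 2 e + ?I 2 3 e + ?I 3 3 e = 1"
    "card {v \<in> e. vdegree G v = 1} = ?I 1 2 e + ?I 1 3 e"
    "card {v \<in> e. vdegree G v = 2} = ?I 1 2 e + 2 * ?I 2 2 e + ?I 2 3 e"
    "card {v \<in> e. vdegree G v = 3} = ?I 1 3 e + ?I 2 3 e + 2 * ?I 3 3 e"
    if eE: "e \<in> edges G" for e
  proof -
    obtain u v where e: "e = {u, v}" "u \<noteq> v" and uv: "u \<in> verts G" "v \<in> verts G"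
      using edge_endsE[OF chemical_simple eE] by metis
    have "\<not> (vdegree G u = 1 \<and> vdegree G v = 1)" using no_leaf_leaf_edge eE e by blast
    moreover have card_ends: "card {w \<in> {u, v}. vdegree G w = i}
        = of_bool (vdegree G u = i) + of_bool (vdegree G v = i)" for i
    proof -
      have "{w \<in> {u, v}. vdegree G w = i}
          = (if vdegree G u = i then {u} else {}) \<union> (if vdegree G v = i then {v} else {})" by auto
      then show ?thesis using e(2) by auto
    qed
    ultimately show "?I 1 2 e + ?I 1 3 e + ?I 2 2 e + ?I 2 3 e + ?I 3 3 e = 1"
      "card {v \<in> e. vdegree G v = 1} = ?I 1 2 e + ?I 1 3 e"
      "card {v \<in> e. vdegree G v = 2} = ?I 1 2 e + 2 * ?I 2 2 e + ?I 2 3 e"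
      "card {v \<in> e. vdegree G v = 3} = ?I 1 3 e + ?I 2 3 e + 2 * ?I 3 3 e"
      using chemical_degree_cases[OF uv(1)] chemical_degree_cases[OF uv(2)]
      unfolding e(1) card_ends in_edge_class_doubleton by (elim disjE; simp)+
  qed
  have inc: "i * N i = (\<Sum>e\<in>edges G. card {v \<in> e. vdegree G v = i})" for i
    unfolding N_def by (rule degree_class_incidences[OF chemical_simple])
  have x: "x i j = (\<Sum>e\<in>edges G. ?I i j e)" for i j
    unfolding x_def by (rule edge_count_eq_sum[OF chemical_simple])
  have "verts G = degree_class G 1 \<union> degree_class G 2 \<union> degree_class G 3"
    using chemical_degree_cases by (auto simp: degree_class_def)
  moreover have "card (degree_class G 1 \<union> degree_class G 2 \<union> degree_class G 3) = N 1 + N 2 + N 3"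
    unfolding N_def using finite_degree_class[OF chemical_simple]
    by (subst card_Un_disjoint; (subst card_Un_disjoint)?) (auto simp: degree_class_def)
  ultimately show "graph_order G = N 1 + N 2 + N 3" by (simp add: graph_order_def)
  have "graph_size G = (\<Sum>e\<in>edges G. 1)" by (simp add: graph_size_def)
  also have "\<dots> = (\<Sum>e\<in>edges G. ?I 1 2 e + ?I 1 3 e + ?I 2 2 e + ?I 2 3 e + ?I 3 3 e)"
    by (rule sum.cong) (simp_all only: ends)
  finally show "graph_size G = x 1 2 + x 1 3 + x 2 2 + x 2 3 + x 3 3"
    unfolding x by (simp only: sum.distrib)
  have "1 * N 1 = (\<Sum>e\<in>edges G. ?I 1 2 e + ?I 1 3 e)"
    unfolding inc by (rule sum.cong) (simp_all only: ends)
  then show "N 1 = x 1 2 + x 1 3" unfolding x by (simp only: sum.distrib mult_1)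
  have "2 * N 2 = (\<Sum>e\<in>edges G. ?I 1 2 e + 2 * ?I 2 2 e + ?I 2 3 e)"
    unfolding inc by (rule sum.cong) (simp_all only: ends)
  then show "2 * N 2 = x 1 2 + 2 * x 2 2 + x 2 3"
    unfolding x by (simp only: sum.distrib sum_distrib_left)
  have "3 * N 3 = (\<Sum>e\<in>edges G. ?I 1 3 e + ?I 2 3 e + 2 * ?I 3 3 e)"
    unfolding inc by (rule sum.cong) (simp_all only: ends)
  then show "3 * N 3 = x 1 3 + x 2 3 + 2 * x 3 3"
    unfolding x by (simp only: sum.distrib sum_distrib_left)
qed

text \<open>
  Without 23-edges, the vertices of degree 3 and the leaves attached to them are closed under
  adjacency, hence they are all the vertices or none. This is how connectedness enters the
  optimization.
\<close>

lemma no_23_edge_imp_empty_class: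
  assumes "edge_count G 2 3 = 0"
  shows "degree_class G 2 = {} \<or> degree_class G 3 = {}"
proof (rule ccontr)
  assume neg: "\<not> ?thesis"
  define S where "S = degree_class G 3 \<union>
    {v \<in> verts G. vdegree G v = 1 \<and> (\<exists>w. {v, w} \<in> edges G \<and> vdegree G w = 3)}"
  obtain a where "a \<in> degree_class G 2" using neg by blast
  then have "a \<in> verts G" "a \<notin> S" by (simp_all add: S_def degree_class_def)
  moreover have "S \<noteq> {}" using neg unfolding S_def by blast
  moreover have "S \<subseteq> verts G" unfolding S_def degree_class_def by blast
  ultimately have "S \<subseteq> verts G" "S \<noteq> {}" "S \<noteq> verts G" by auto
  then obtain u v where uv: "u \<in> S" "v \<notin> S" "{u, v} \<in> edges G"
    using connected_crossing_edge[OF chemical_connected] by metis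
  have v: "v \<in> verts G" using uv(3) chemical_simple by (auto simp: simple_graph_def)
  have vu: "{v, u} \<in> edges G" using uv(3) by (simp add: insert_commute)
  show False
  proof (cases "vdegree G u = 3")
    case True
    then have "vdegree G v = 2"
      using uv(2) v vu chemical_degree_cases[OF v] by (auto simp: S_def degree_class_def)
    then show False
      using assms edge_count_eq_0_iff[OF chemical_simple, of 2 3] vu True by blast
  next
    case False
    then obtain w where "vdegree G u = 1" "{u, w} \<in> edges G" "vdegree G w = 3"
      using uv(1) by (auto simp: S_def degree_class_def)
    then have "vdegree G v = 3" using leaf_unique_neighbour[of u v w] uv(3) by simp
    then show False using uv(2) v by (auto simp: S_def degree_class_def)
  qed
qed

lemma edge_count_33_le:
  "edge_count G 3 3 \<le> card (degree_class G 3) choose 2"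
proof -
  have "{e \<in> edges G. \<exists>u v. e = {u, v} \<and> vdegree G u = 3 \<and> vdegree G v = 3}
      \<subseteq> {e. e \<subseteq> degree_class G 3 \<and> card e = 2}"
    using chemical_simple by (auto simp: simple_graph_def degree_class_def)
  then have "edge_count G 3 3 \<le> card {e. e \<subseteq> degree_class G 3 \<and> card e = 2}"
    unfolding edge_count_def using finite_degree_class[OF chemical_simple]
    by (intro card_mono) (auto intro: finite_subset[of _ "Pow (degree_class G 3)"])
  also have "\<dots> = card (degree_class G 3) choose 2"
    by (rule n_subsets[OF finite_degree_class[OF chemical_simple]])
  finally show ?thesis .
qed

end

section \<open>The two families in terms of three edge counts each\<close>

text \<open>
  The remaining edge counts \<open>x\<^sub>1\<^sub>3\<close> and \<open>x\<^sub>3\<^sub>3\<close> in the definition of \<open>F1\<close>, and \<open>x\<^sub>2\<^sub>2\<close> and \<open>x\<^sub>3\<^sub>3\<close> in that of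
  \<open>F2\<close>, follow from the balance relations. In this form membership says that the variables of
  the respective linear program take their optimal values.
\<close>

lemma F1_iff:
  assumes "chemical_graph G"
  shows "G \<in> F1 \<longleftrightarrow> edge_count G 1 2 = 0 \<and> edge_count G 2 2 = 0 \<and>
           edge_count G 2 3 = (if even (graph_order G) then 0 else 2)"
proof -
  note b = chemical_balance[OF assms]
  show ?thesis
    using b assms unfolding F1_def edge_counts_def Let_def by (cases "even (graph_order G)") auto
qed

lemma F2_iff:
  assumes "chemical_graph G"
  shows "G \<in> F2 \<longleftrightarrow> edge_count G 1 3 = 0 \<and>
           edge_count G 1 2 = (if graph_size G < graph_order G then 2 else 0) \<and>
           edge_count G 2 3 = (if graph_size G \<le> graph_order G then 0
             else if graph_size G = graph_order G + 1 then 4 else 2)"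
proof -
  note b = chemical_balance[OF assms]
  have le: "graph_order G \<le> graph_size G + 1"
    using connected_order_le_size chemical_simple[OF assms] chemical_connected[OF assms] .
  have sz: "real (graph_size G) \<le> (3 * real (graph_order G) - 3) / 2"
    using assms by (simp add: chemical_graph_def)
  consider "graph_order G = graph_size G + 1" | "graph_size G = graph_order G"
    | "graph_size G = graph_order G + 1" | "graph_size G > graph_order G + 1"
    using le by linarith
  then show ?thesis
    by cases (use b assms sz in \<open>auto simp: F2_def edge_counts_def Let_def\<close>)
qed

section \<open>The two linear programs\<close>

definition cost_12_13_23 :: "real \<Rightarrow> real \<Rightarrow> real \<Rightarrow> 'a ugraph \<Rightarrow> real" where
  "cost_12_13_23 p q r G =
     p * real (edge_count G 1 2) + q * real (edge_count G 1 3) + r * real (edge_count G 2 3)"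

definition cost_12_22_23 :: "real \<Rightarrow> real \<Rightarrow> real \<Rightarrow> 'a ugraph \<Rightarrow> real" where
  "cost_12_22_23 a b c G =
     a * real (edge_count G 1 2) + b * real (edge_count G 2 2) + c * real (edge_count G 2 3)"

lemma F1_cost_eq:
  assumes "H \<in> F1"
  shows "cost_12_22_23 a b c H = (if even (graph_order H) then 0 else 2 * c)"
proof -
  have "chemical_graph H" using assms by (simp add: F1_def)
  then show ?thesis using F1_iff[of H] assms by (auto simp: cost_12_22_23_def)
qed

lemma F2_cost_eq:
  assumes "H \<in> F2"
  shows "cost_12_13_23 p q r H = (if graph_size H < graph_order H then 2 * p
     else if graph_size H = graph_order H then 0
     else if graph_size H = graph_order H + 1 then 4 * r else 2 * r)"
proof -
  have "chemical_graph H" using assms by (simp add: F2_def)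
  then show ?thesis using F2_iff[of H] assms by (auto simp: cost_12_13_23_def)
qed

text \<open>
  Write the cost as \<open>c (x\<^sub>1\<^sub>2 + 2 x\<^sub>2\<^sub>2 + x\<^sub>2\<^sub>3) + (a - c) x\<^sub>1\<^sub>2 + (b - 2 c) x\<^sub>2\<^sub>2\<close>. The first bracket is twice the
  number of vertices of degree 2, which is odd when \<open>n\<close> is odd and so at least 1; the other
  two terms are positive unless \<open>x\<^sub>1\<^sub>2 = x\<^sub>2\<^sub>2 = 0\<close>.
\<close>

lemma F1_cost_less:
  assumes "0 < c" "c < a" "2 * c < b"
    and H: "H \<in> F1" and G: "chemical_graph G" "G \<notin> F1"
    and order: "graph_order H = graph_order G"
  shows "cost_12_22_23 a b c H < cost_12_22_23 a b c G"
proof -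
  note bal = chemical_balance[OF G(1)]
  define x y z where "x = edge_count G 1 2" and "y = edge_count G 2 2" and "z = edge_count G 2 3"
  have cost: "cost_12_22_23 a b c G
      = c * real (x + 2 * y + z) + (a - c) * real x + (b - 2 * c) * real y"
    by (simp add: cost_12_22_23_def x_def y_def z_def algebra_simps)
  have nonneg: "0 \<le> (a - c) * real x" "0 \<le> (b - 2 * c) * real y" using assms(2,3) by simp_all
  have pos: "0 < (a - c) * real x + (b - 2 * c) * real y" if "x \<noteq> 0 \<or> y \<noteq> 0"
  proof (cases "x = 0")
    case True
    then have "0 < (b - 2 * c) * real y" using that assms(3) by simp
    then show ?thesis using nonneg by linarith
  next
    case False
    then have "0 < (a - c) * real x" using assms(2) by simp
    then show ?thesis using nonneg by linarith
  qed
  have N2: "2 * card (degree_class G 2) = x + 2 * y + z"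
    using bal by (simp add: x_def y_def z_def)
  show ?thesis
  proof (cases "even (graph_order G)")
    case True
    then have "x \<noteq> 0 \<or> y \<noteq> 0 \<or> z \<noteq> 0"
      using F1_iff[OF G(1)] G(2) by (auto simp: x_def y_def z_def)
    moreover have "0 < c * real (x + 2 * y + z)" if "z \<noteq> 0" using that assms(1) by simp
    moreover have "0 \<le> c * real (x + 2 * y + z)" using assms(1) by simp
    ultimately have "0 < cost_12_22_23 a b c G" unfolding cost using pos nonneg by linarith
    moreover have "cost_12_22_23 a b c H = 0"
      using F1_cost_eq[OF H] True unfolding order by (simp only: if_True)
    ultimately show ?thesis by simp
  next
    case False
    have "2 * graph_size G
        = card (degree_class G 1) + 2 * card (degree_class G 2) + 3 * card (degree_class G 3)"
      using bal by linarith
    then have "odd (card (degree_class G 2))" using False bal(1) by presburger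
    then have ge: "2 \<le> x + 2 * y + z" using N2 by presburger
    then have le: "c * 2 \<le> c * real (x + 2 * y + z)" using assms(1) by (intro mult_left_mono) auto
    have "c * 2 < cost_12_22_23 a b c G"
    proof (cases "x = 0 \<and> y = 0")
      case True
      then have "z \<noteq> 2" using F1_iff[OF G(1)] G(2) False by (auto simp: x_def y_def z_def)
      then have "2 < real (x + 2 * y + z)" using True ge by simp
      then have "c * 2 < c * real (x + 2 * y + z)" using assms(1) by (intro mult_strict_left_mono)
      then show ?thesis unfolding cost using nonneg by linarith
    next
      case False
      then show ?thesis unfolding cost using le pos by linarith
    qed
    moreover have "cost_12_22_23 a b c H = 2 * c"
      using F1_cost_eq[OF H] False unfolding order by (simp only: if_False)
    ultimately show ?thesis by simp
  qed
qed

text \<open>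
  The difference \<open>N\<^sub>3 - N\<^sub>1 = 2 (m - n)\<close> of the numbers of vertices of degrees 3 and 1 splits the proof. A
  tree that is not a path has at least three leaves, each costing at least \<open>p\<close>, while the path
  costs \<open>2 p\<close>; if \<open>m = n\<close>, only the cycle costs nothing. If \<open>m > n\<close>, a single 13-edge already costs more than
  the optimum, because \<open>q > 4 r\<close>. Without 13-edges every leaf yields a 12-edge, hence a vertex of
  degree 2 and so a 23-edge, and the 12-edges together with the remaining 23-edges cost more than
  the 23-edges of a graph without leaves.
\<close>

lemma F2_cost_less:
  assumes "0 < r" "r < p" "p < q" "4 * r < q"
    and H: "H \<in> F2" and G: "chemical_graph G" "G \<notin> F2"
    and order: "graph_order H = graph_order G" and size: "graph_size H = graph_size G"
  shows "cost_12_13_23 p q r H < cost_12_13_23 p q r G"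
proof -
  note bal = chemical_balance[OF G(1)]
  define x y z where "x = edge_count G 1 2" and "y = edge_count G 1 3" and "z = edge_count G 2 3"
  define w where "w = edge_count G 3 3"
  define N1 N2 N3 where "N1 = card (degree_class G 1)" and "N2 = card (degree_class G 2)"
    and "N3 = card (degree_class G 3)"
  define m n where "m = graph_size G" and "n = graph_order G"
  have N1: "N1 = x + y" and N3: "3 * N3 = y + z + 2 * w" and n: "n = N1 + N2 + N3"
    and m: "2 * m = N1 + 2 * N2 + 3 * N3" and xN2: "x \<le> 2 * N2"
    using bal by (simp_all add: x_def y_def z_def w_def N1_def N2_def N3_def m_def n_def)
  have "x + z = 2 * (N2 - edge_count G 2 2)" using bal(4) by (simp add: x_def z_def N2_def)
  then have xz: "even (x + z)" by simp
  have "n \<le> m + 1"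
    unfolding n_def m_def
    by (intro connected_order_le_size chemical_simple chemical_connected G(1))
  have m_le: "2 * m + 3 \<le> 3 * n" using chemical_size[OF G(1)] by (simp add: m_def n_def)
  have z_pos: "z = 0 \<Longrightarrow> N2 = 0 \<or> N3 = 0"
    using no_23_edge_imp_empty_class[OF G(1)] by (auto simp: z_def N2_def N3_def)
  have w_le: "w \<le> N3 choose 2" using edge_count_33_le[OF G(1)] by (simp add: w_def N3_def)
  have notF2: "\<not> (y = 0 \<and> x = (if m < n then 2 else 0) \<and>
      z = (if m \<le> n then 0 else if m = n + 1 then 4 else 2))"
    using F2_iff[OF G(1)] G(2) unfolding x_def y_def z_def m_def n_def by blast
  have lower: "p * real i + q * real j + r * real k \<le> cost_12_13_23 p q r G"
    if "i \<le> x" "j \<le> y" "k \<le> z" for i j k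
    unfolding cost_12_13_23_def x_def[symmetric] y_def[symmetric] z_def[symmetric]
    using that assms(1-3) by (intro add_mono mult_left_mono) auto
  have cost_H: "cost_12_13_23 p q r H = (if m < n then 2 * p else if m = n then 0
     else if m = n + 1 then 4 * r else 2 * r)"
    using F2_cost_eq[OF H, of p q r] order size by (simp add: m_def n_def)
  consider "n = m + 1" | "m = n" | "m = n + 1" | "m > n + 1" using \<open>n \<le> m + 1\<close> by linarith
  then show ?thesis
  proof cases
    case 1
    then have "N1 = N3 + 2" using n m by linarith
    moreover have "N3 \<noteq> 0"
    proof
      assume "N3 = 0"
      then have "y = 0" "z = 0" "x = 2" using N3 N1 \<open>N1 = N3 + 2\<close> by auto
      then show False using notF2 1 by simp
    qed
    ultimately have "3 \<le> x + y" using N1 by linarith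
    then have "p * 3 \<le> p * real (x + y)" using assms(1,2) by (intro mult_left_mono) auto
    also have "\<dots> \<le> p * real x + q * real y"
      using mult_right_mono[of p q "real y"] assms(3) by (simp add: algebra_simps)
    finally show ?thesis using lower[of x y 0] cost_H 1 assms(1,2) by auto
  next
    case 2
    then have "\<not> (y = 0 \<and> x = 0 \<and> z = 0)" using notF2 by simp
    then consider "1 \<le> x" | "1 \<le> y" | "1 \<le> z" by linarith
    then have "0 < cost_12_13_23 p q r G"
    proof cases
      case 1
      show ?thesis using lower[OF 1, of 0 0] assms(1-3) by simp
    next
      case 2
      show ?thesis using lower[OF _ 2, of 0 0] assms(1-3) by simp
    next
      case 3
      show ?thesis using lower[OF _ _ 3, of 0 0] assms(1-3) by simp
    qed
    then show ?thesis using cost_H 2 by simp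
  next
    case 3
    \<comment> \<open>At most one edge joins two vertices of degree 3, and at most three join three of them;
      this keeps \<open>z\<close> large when there are few leaves.\<close>
    then have N13: "N3 = N1 + 2" using n m by linarith
    have "4 * r < cost_12_13_23 p q r G"
    proof (cases "y = 0")
      case False
      then show ?thesis using lower[of 0 1 0] assms(4) by simp
    next
      case True
      have z: "z \<noteq> 0" if "x \<noteq> 0"
      proof
        assume "z = 0"
        from z_pos[OF this] show False using that xN2 N13 by linarith
      qed
      consider "x = 0" | "x = 1" | "x = 2" | "3 \<le> x" by linarith
      then show ?thesis
      proof cases
        case 1
        then have "N3 = 2" using N1 N13 True by simp
        then have "w \<le> 1" using w_le by (simp add: choose_two)
        then have "5 \<le> z" using N3 \<open>N3 = 2\<close> True notF2 3 1 by auto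
        then show ?thesis using lower[of 0 0 5] assms(1) by simp
      next
        case 2
        then have "N3 = 3" using N1 N13 True by simp
        then have "w \<le> 3" using w_le by (simp add: choose_two)
        then have "3 \<le> z" using N3 \<open>N3 = 3\<close> True by simp
        then show ?thesis using lower[of 1 0 3] 2 assms(2) by simp
      next
        case x: 3
        then have "z \<noteq> 0" "even z" using z xz by simp_all
        then have "2 \<le> z" by presburger
        then show ?thesis using lower[of 2 0 2] x assms(2) by simp
      next
        case 4
        then have "z \<noteq> 0" by (intro z) simp
        then have "1 \<le> z" by simp
        then show ?thesis using lower[of 3 0 1] 4 assms(2) by simp
      qed
    qed
    then show ?thesis using cost_H 3 by simp
  next
    case 4
    then have N3_pos: "N3 \<noteq> 0" using n m by linarith
    have "2 * r < cost_12_13_23 p q r G"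
    proof (cases "y = 0")
      case False
      then show ?thesis using lower[of 0 1 0] assms(1,4) by simp
    next
      case True
      have "z \<noteq> 0"
      proof
        assume "z = 0"
        then have "N2 = 0" using z_pos N3_pos by simp
        then have "N1 = 0" using N1 xN2 True by simp
        then show False using \<open>N2 = 0\<close> n m m_le by linarith
      qed
      show ?thesis
      proof (cases "x = 0")
        case x: True
        then have "z \<noteq> 2" using notF2 True 4 by simp
        moreover have "z \<noteq> 1" using xz x by auto
        ultimately have "3 \<le> z" using \<open>z \<noteq> 0\<close> by linarith
        then show ?thesis using lower[of 0 0 3] assms(1) by simp
      next
        case False
        then show ?thesis using lower[of 1 0 1] \<open>z \<noteq> 0\<close> assms(2) by simp
      qed
    qed
    then show ?thesis using cost_H 4 by simp
  qed
qed

section \<open>The thirteen indices\<close>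

text \<open>
  The coefficients \<open>p\<close>, \<open>q\<close> and \<open>r\<close> that 12-, 13- and 23-edges retain once \<open>n\<close> and \<open>m\<close> have been used to
  eliminate the 22- and 33-edges from an index.
\<close>

definition excess12 :: "(nat \<Rightarrow> nat \<Rightarrow> real) \<Rightarrow> real" where
  "excess12 c = c 1 2 - 5 / 2 * c 2 2 + 3 / 2 * c 3 3"

definition excess13 :: "(nat \<Rightarrow> nat \<Rightarrow> real) \<Rightarrow> real" where
  "excess13 c = c 1 3 - 2 * c 2 2 + c 3 3"

definition excess23 :: "(nat \<Rightarrow> nat \<Rightarrow> real) \<Rightarrow> real" where
  "excess23 c = c 2 3 - 1 / 2 * c 2 2 - 1 / 2 * c 3 3"

text \<open>
  The relations between the three excesses that make both linear programs have positive
  coefficients of the right relative size. The sign \<open>s\<close> is 1 if \<open>F1\<close> maximizes the index, and -1 if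
  \<open>F1\<close> minimizes it.
\<close>

definition excess_ordered :: "real \<Rightarrow> (nat \<Rightarrow> nat \<Rightarrow> real) \<Rightarrow> bool" where
  "excess_ordered s c \<longleftrightarrow> 0 < s * excess23 c \<and> s * excess23 c < s * excess12 c \<and>
     s * excess12 c < s * excess13 c \<and> 4 * (s * excess23 c) < s * excess13 c"

lemma sqrt_boundsI:
  assumes "0 \<le> l" "0 \<le> u" "l * l \<le> x" "x \<le> u * u"
  shows "l \<le> sqrt x \<and> sqrt x \<le> u"
  using assms by (auto intro!: real_le_rsqrt real_le_lsqrt simp: power2_eq_square)

text \<open>
  Five decimals suffice, since the smallest gap in any of the inequalities exceeds \<open>0.004\<close>.
\<close>

lemma sqrt_bounds:
  "1.41421 \<le> sqrt 2 \<and> sqrt 2 \<le> 1.41422"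
  "1.73205 \<le> sqrt 3 \<and> sqrt 3 \<le> 1.73206"
  "2.23606 \<le> sqrt 5 \<and> sqrt 5 \<le> 2.23607"
  "2.44948 \<le> sqrt 6 \<and> sqrt 6 \<le> 2.44950"
  "2.64575 \<le> sqrt 7 \<and> sqrt 7 \<le> 2.64576"
  "2.82842 \<le> sqrt 8 \<and> sqrt 8 \<le> 2.82843"
  "3.16227 \<le> sqrt 10 \<and> sqrt 10 \<le> 3.16228"
  "3.31662 \<le> sqrt 11 \<and> sqrt 11 \<le> 3.31663"
  "3.60555 \<le> sqrt 13 \<and> sqrt 13 \<le> 3.60556"
  "3.87298 \<le> sqrt 15 \<and> sqrt 15 \<le> 3.87299"
  "4.24264 \<le> sqrt 18 \<and> sqrt 18 \<le> 4.24265"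
  by (rule sqrt_boundsI; simp)+

lemma sqrt_fraction_bounds:
  "0.57735 \<le> sqrt (1 / 3) \<and> sqrt (1 / 3) \<le> 0.57736"
  "0.70710 \<le> sqrt (1 / 2) \<and> sqrt (1 / 2) \<le> 0.70711"
  "0.77459 \<le> sqrt (3 / 5) \<and> sqrt (3 / 5) \<le> 0.77460"
  "0.81649 \<le> sqrt (2 / 3) \<and> sqrt (2 / 3) \<le> 0.81650"
  by (rule sqrt_boundsI; simp)+

lemma divide_sqrt:
  assumes "0 < x" shows "a / sqrt x = a * sqrt x / x" "a / (b * sqrt x) = a * sqrt x / (b * x)"
proof -
  have "sqrt x \<noteq> 0" "x \<noteq> 0" "sqrt x * sqrt x = x" using assms by simp_all
  then show "a / sqrt x = a * sqrt x / x" "a / (b * sqrt x) = a * sqrt x / (b * x)"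
    by (simp_all add: divide_simps)
qed

lemmas excess_defs = excess_ordered_def excess12_def excess13_def excess23_def

text \<open>
  After exponentiation the four inequalities become
  \<open>24 < 25\<close>, \<open>20 < 27\<close>, \<open>27 < 32\<close> and \<open>625 < 864\<close>.
\<close>

lemma ln_Zagreb_ordered:
  "excess_ordered 1 (\<lambda>i j. coefficient LnZagreb1 (real i) (real j))"
proof -
  have products: "ln 4 = 2 * ln (2::real)" "ln 6 = ln 2 + ln (3::real)" "ln 8 = 3 * ln (2::real)"
    "ln 32 = 5 * ln (2::real)" "ln 27 = 3 * ln (3::real)" "ln 25 = 2 * ln (5::real)"
    "ln 625 = 4 * ln (5::real)"
    using ln_mult[of 2 "3::real"] ln_realpow[of "2::real" 2] ln_realpow[of "2::real" 3]
      ln_realpow[of "2::real" 5] ln_realpow[of "3::real" 3] ln_realpow[of "5::real" 2]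
      ln_realpow[of "5::real" 4] by simp_all
  have "ln (8 * 3) < ln (25::real)" "ln (4 * 5) < ln (27::real)" "ln 27 < ln (32::real)"
    "ln 625 < ln (32 * 27::real)"
    by simp_all
  then have "3 * ln 2 + ln 3 < 2 * ln (5::real)" "2 * ln 2 + ln 5 < 3 * ln (3::real)"
    "3 * ln 3 < 5 * ln (2::real)" "4 * ln 5 < 5 * ln 2 + 3 * ln (3::real)"
    unfolding products[symmetric] by (simp_all only: ln_mult_pos)
  then show ?thesis
    unfolding excess_defs by (auto simp: products field_simps)
qed

lemma index_excess_ordered:
  "\<exists>s. (s = 1 \<or> s = -1) \<and> excess_ordered s (\<lambda>i j. coefficient t (real i) (real j))"
proof (cases t)
  case ABSC
  have "excess_ordered 1 (\<lambda>i j. coefficient ABSC (real i) (real j))"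
    unfolding excess_defs using sqrt_fraction_bounds by simp
  then show ?thesis using ABSC by blast
next
  case AG
  have "excess_ordered 1 (\<lambda>i j. coefficient AG (real i) (real j))"
    unfolding excess_defs using sqrt_bounds by (simp add: divide_sqrt)
  then show ?thesis using AG by blast
next
  case AG_GA
  have "excess_ordered 1 (\<lambda>i j. coefficient AG_GA (real i) (real j))"
    unfolding excess_defs using sqrt_bounds by (simp add: divide_sqrt)
  then show ?thesis using AG_GA by blast
next
  case Extended
  have "excess_ordered 1 (\<lambda>i j. coefficient Extended (real i) (real j))"
    unfolding excess_defs by simp
  then show ?thesis using Extended by blast
next
  case GA
  have "excess_ordered (-1) (\<lambda>i j. coefficient GA (real i) (real j))"
    unfolding excess_defs using sqrt_bounds by simp
  then show ?thesis using GA by blast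
next
  case GouravaSC
  have "excess_ordered (-1) (\<lambda>i j. coefficient GouravaSC (real i) (real j))"
    unfolding excess_defs using sqrt_bounds by (simp add: divide_sqrt)
  then show ?thesis using GouravaSC by blast
next
  case Harmonic
  have "excess_ordered (-1) (\<lambda>i j. coefficient Harmonic (real i) (real j))"
    unfolding excess_defs by simp
  then show ?thesis using Harmonic by blast
next
  case Randic
  have "excess_ordered (-1) (\<lambda>i j. coefficient Randic (real i) (real j))"
    unfolding excess_defs using sqrt_bounds by (simp add: divide_sqrt)
  then show ?thesis using Randic by blast
next
  case Sombor
  have "excess_ordered 1 (\<lambda>i j. coefficient Sombor (real i) (real j))"
    unfolding excess_defs using sqrt_bounds by simp
  then show ?thesis using Sombor by blast
next
  case RSombor
  have "excess_ordered 1 (\<lambda>i j. coefficient RSombor (real i) (real j))"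
    unfolding excess_defs using sqrt_bounds by simp
  then show ?thesis using RSombor by blast
next
  case SumConn
  have "excess_ordered (-1) (\<lambda>i j. coefficient SumConn (real i) (real j))"
    unfolding excess_defs using sqrt_bounds by (simp add: divide_sqrt)
  then show ?thesis using SumConn by blast
next
  case RSumConn
  have "excess_ordered 1 (\<lambda>i j. coefficient RSumConn (real i) (real j))"
    unfolding excess_defs using sqrt_bounds by simp
  then show ?thesis using RSumConn by blast
next
  case LnZagreb1
  then show ?thesis using ln_Zagreb_ordered by blast
qed

section \<open>Graphs given by links between numbered vertices\<close>

text \<open>
  Concrete graphs are described by pairs \<open>(i, j)\<close> with \<open>i < j\<close>, so that each edge has exactly one
  description. The labelling \<open>h\<close> places them on an arbitrary set of \<open>n\<close> vertices, as the
  competitors of a given graph have to live in its vertex type.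
\<close>

definition labelled_graph :: "(nat \<Rightarrow> 'a) \<Rightarrow> nat \<Rightarrow> (nat \<times> nat) set \<Rightarrow> 'a ugraph" where
  "labelled_graph h n R = \<lparr>verts = h ` {..<n}, edges = (\<lambda>(i, j). {h i, h j}) ` R\<rparr>"

definition link_degree :: "(nat \<times> nat) set \<Rightarrow> nat \<Rightarrow> nat" where
  "link_degree R v = card {r \<in> R. fst r = v \<or> snd r = v}"

definition links :: "(nat \<Rightarrow> nat) \<Rightarrow> (nat \<Rightarrow> nat) \<Rightarrow> nat \<Rightarrow> (nat \<times> nat) set" where
  "links f g k = (\<lambda>i. (f i, g i)) ` {..<k}"

lemma finite_links [simp]: "finite (links f g k)"
  by (simp add: links_def)

lemma in_links_iff: "(a, b) \<in> links f g k \<longleftrightarrow> (\<exists>i<k. a = f i \<and> b = g i)"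
  by (auto simp: links_def)

lemma card_links: "inj_on g {..<k} \<Longrightarrow> card (links f g k) = k"
  unfolding links_def by (subst card_image) (auto simp: inj_on_def)

lemma link_degree_links:
  assumes "inj_on f {..<k}" "inj_on g {..<k}" "\<And>i. i < k \<Longrightarrow> f i < g i"
  shows "link_degree (links f g k) v = of_bool (v \<in> f ` {..<k}) + of_bool (v \<in> g ` {..<k})"
proof -
  have "card {r \<in> links f g k. fst r = v} = of_bool (v \<in> f ` {..<k})"
  proof (cases "v \<in> f ` {..<k}")
    case True
    then obtain i where i: "i < k" "v = f i" by blast
    have uniq: "f j = f i \<Longrightarrow> j < k \<Longrightarrow> j = i" for j
      using inj_onD[OF assms(1)] i(1) by simp
    have "{r \<in> links f g k. fst r = v} = {(f i, g i)}"
      using i by (auto simp: links_def dest: uniq)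
    then show ?thesis using True by simp
  next
    case False
    then have "{r \<in> links f g k. fst r = v} = {}" by (auto simp: links_def)
    then show ?thesis using False by (simp only: card.empty of_bool_eq)
  qed
  moreover have "card {r \<in> links f g k. snd r = v} = of_bool (v \<in> g ` {..<k})"
  proof (cases "v \<in> g ` {..<k}")
    case True
    then obtain i where i: "i < k" "v = g i" by blast
    have uniq: "g j = g i \<Longrightarrow> j < k \<Longrightarrow> j = i" for j
      using inj_onD[OF assms(2)] i(1) by simp
    have "{r \<in> links f g k. snd r = v} = {(f i, g i)}"
      using i by (auto simp: links_def dest: uniq)
    then show ?thesis using True by simp
  next
    case False
    then have "{r \<in> links f g k. snd r = v} = {}" by (auto simp: links_def)
    then show ?thesis using False by (simp only: card.empty of_bool_eq)
  qed
  moreover have "{r \<in> links f g k. fst r = v \<or> snd r = v}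
      = {r \<in> links f g k. fst r = v} \<union> {r \<in> links f g k. snd r = v}" by blast
  moreover have "{r \<in> links f g k. fst r = v} \<inter> {r \<in> links f g k. snd r = v} = {}"
    using assms(3) by (fastforce simp: links_def)
  ultimately show ?thesis unfolding link_degree_def by (simp add: card_Un_disjoint)
qed

lemma link_degree_Un:
  assumes "finite R" "finite S" "R \<inter> S = {}"
  shows "link_degree (R \<union> S) v = link_degree R v + link_degree S v"
proof -
  have "{r \<in> R \<union> S. fst r = v \<or> snd r = v}
      = {r \<in> R. fst r = v \<or> snd r = v} \<union> {r \<in> S. fst r = v \<or> snd r = v}" by blast
  then show ?thesis
    using assms unfolding link_degree_def by (simp add: card_Un_disjoint disjoint_iff)
qed

locale labelled =
  fixes h :: "nat \<Rightarrow> 'a" and n :: nat and R :: "(nat \<times> nat) set"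
  assumes inj: "inj_on h {..<n}"
    and links_less: "\<And>i j. (i, j) \<in> R \<Longrightarrow> i < j \<and> j < n"
begin

abbreviation "G \<equiv> labelled_graph h n R"

lemma finite_R: "finite R"
  by (rule finite_subset[of _ "{..<n} \<times> {..<n}"]) (use links_less in fastforce)+

lemma h_eq_iff: "i < n \<Longrightarrow> j < n \<Longrightarrow> h i = h j \<longleftrightarrow> i = j"
  using inj by (auto simp: inj_on_def)

lemma inj_on_links: "inj_on (\<lambda>(i, j). {h i, h j}) R"
proof (rule inj_onI, clarify)
  fix i j i' j' assume R: "(i, j) \<in> R" "(i', j') \<in> R" and eq: "{h i, h j} = {h i', h j'}"
  have less: "i < j" "j < n" "i' < j'" "j' < n" using R links_less by blast+
  then show "i = i' \<and> j = j'" using eq by (auto simp: doubleton_eq_iff h_eq_iff)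
qed

lemma order_eq: "graph_order G = n"
  using inj by (simp add: graph_order_def labelled_graph_def card_image)

lemma size_eq: "graph_size G = card R"
  using inj_on_links by (simp add: graph_size_def labelled_graph_def card_image)

lemma simple: "simple_graph G"
  unfolding simple_graph_def
proof (intro conjI ballI)
  show "finite (verts G)" by (simp add: labelled_graph_def)
  fix e assume "e \<in> edges G"
  then obtain i j where e: "e = {h i, h j}" and ij: "(i, j) \<in> R" by (auto simp: labelled_graph_def)
  have "i < j" "j < n" using links_less[OF ij] by auto
  then show "e \<subseteq> verts G" "card e = 2" using e by (auto simp: labelled_graph_def h_eq_iff)
qed

lemma vdegree_eq:
  assumes "v < n" shows "vdegree G (h v) = link_degree R v"
proof -
  have "{e \<in> edges G. h v \<in> e} = (\<lambda>(i, j). {h i, h j}) ` {r \<in> R. fst r = v \<or> snd r = v}"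
  proof -
    have "h v \<in> {h i, h j} \<longleftrightarrow> i = v \<or> j = v" if "(i, j) \<in> R" for i j
      using links_less[OF that] assms h_eq_iff[of v i] h_eq_iff[of v j] by auto
    then show ?thesis by (fastforce simp: labelled_graph_def)
  qed
  moreover have "inj_on (\<lambda>(i, j). {h i, h j}) {r \<in> R. fst r = v \<or> snd r = v}"
    using inj_on_links by (rule inj_on_subset) blast
  ultimately show ?thesis by (simp add: vdegree_def link_degree_def card_image)
qed

text \<open>
  Vertex \<open>0\<close> is reached from everywhere by descending through smaller labels.
\<close>

lemma connected:
  assumes "0 < n" and earlier: "\<And>j. 0 < j \<Longrightarrow> j < n \<Longrightarrow> \<exists>i. (i, j) \<in> R"
  shows "connected_graph G"
proof -
  let ?E = "{(a, b). {a, b} \<in> edges G}"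
  have sym: "sym (?E\<^sup>*)" by (intro sym_rtrancl) (auto simp: sym_def insert_commute)
  have to0: "(h 0, h j) \<in> ?E\<^sup>*" if "j < n" for j
    using that
  proof (induction j rule: less_induct)
    case (less j)
    show ?case
    proof (cases "j = 0")
      case False
      then obtain i where i: "(i, j) \<in> R" using earlier less.prems by blast
      then have "i < j" using links_less by blast
      then have "(h 0, h i) \<in> ?E\<^sup>*" using less by simp
      moreover have "(h i, h j) \<in> ?E" using i by (force simp: labelled_graph_def)
      ultimately show ?thesis by (rule rtrancl_into_rtrancl)
    qed simp
  qed
  have "(u, v) \<in> ?E\<^sup>*" if uv: "u \<in> verts G" "v \<in> verts G" for u v
  proof -
    obtain i j where "u = h i" "v = h j" "i < n" "j < n"
      using uv by (auto simp: labelled_graph_def)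
    then have "(u, h 0) \<in> ?E\<^sup>*" "(h 0, v) \<in> ?E\<^sup>*" using to0 symD[OF sym] by auto
    then show ?thesis by (rule rtrancl_trans)
  qed
  then show ?thesis using assms(1) by (auto simp: connected_graph_def labelled_graph_def)
qed

lemma chemical:
  assumes "7 \<le> n" "2 * card R + 3 \<le> 3 * n" "\<And>j. 0 < j \<Longrightarrow> j < n \<Longrightarrow> \<exists>i. (i, j) \<in> R"
    and "\<And>v. v < n \<Longrightarrow> link_degree R v \<le> 3"
  shows "chemical_graph G"
  unfolding chemical_graph_def order_eq size_eq
proof (intro conjI ballI)
  show "connected_graph G" using assms(1,3) by (intro connected) auto
  show "real (card R) \<le> (3 * real n - 3) / 2" using of_nat_mono[OF assms(2), where 'a = real] by simp
  fix v assume "v \<in> verts G"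
  then show "vdegree G v \<le> 3" using vdegree_eq assms(4) by (auto simp: labelled_graph_def)
qed (use simple assms(1) in auto)

lemma degree_class_eq: "degree_class G i = h ` {v. v < n \<and> link_degree R v = i}"
  unfolding degree_class_def using vdegree_eq by (auto simp: labelled_graph_def)

lemma card_degree_class: "card (degree_class G i) = card {v. v < n \<and> link_degree R v = i}"
  unfolding degree_class_eq using inj by (intro card_image) (auto elim: inj_on_subset)

lemma edge_count_links:
  "edge_count G i j = card {(a, b) \<in> R. link_degree R a = i \<and> link_degree R b = j \<or>
     link_degree R a = j \<and> link_degree R b = i}" (is "_ = card ?S")
proof -
  have deg: "in_edge_class G i j {h a, h b} \<longleftrightarrow> link_degree R a = i \<and> link_degree R b = j \<or>
      link_degree R a = j \<and> link_degree R b = i" if "(a, b) \<in> R" for a b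
    using links_less[OF that] by (simp add: in_edge_class_doubleton vdegree_eq)
  have "{e \<in> edges G. in_edge_class G i j e} = (\<lambda>(i, j). {h i, h j}) ` ?S"
    using deg by (fastforce simp: labelled_graph_def)
  moreover have "inj_on (\<lambda>(i, j). {h i, h j}) ?S"
    using inj_on_links by (rule inj_on_subset) blast
  ultimately show ?thesis
    unfolding edge_count_def in_edge_class_def[symmetric] by (simp add: card_image)
qed

text \<open>
  With no vertex of degree 2 (even order) there are no 12-, 22- or 23-edges. With a single one (odd
  order), its two edges are 23-edges as soon as none of them leads to a leaf.
\<close>

lemma in_F1:
  assumes chem: "chemical_graph G" and w: "w < n"
    and two: "\<And>v. v < n \<Longrightarrow> link_degree R v = 2 \<longleftrightarrow> odd n \<and> v = w"
    and leaf: "\<And>a b. (a, b) \<in> R \<Longrightarrow> odd n \<Longrightarrow>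
      \<not> (a = w \<and> link_degree R b = 1) \<and> \<not> (b = w \<and> link_degree R a = 1)"
  shows "G \<in> F1"
proof -
  note bal = chemical_balance[OF chem]
  show ?thesis
  proof (cases "odd n")
    case False
    then have "{v. v < n \<and> link_degree R v = 2} = {}" using two by auto
    then have "card (degree_class G 2) = 0" by (simp only: card_degree_class card.empty)
    then show ?thesis using bal(4) False by (simp add: F1_iff[OF chem] order_eq)
  next
    case True
    then have "{v. v < n \<and> link_degree R v = 2} = {w}" using two w by auto
    then have one: "card (degree_class G 2) = 1" by (simp add: card_degree_class)
    have "{(a, b) \<in> R. link_degree R a = 1 \<and> link_degree R b = 2 \<or>
        link_degree R a = 2 \<and> link_degree R b = 1} = {}"
      using leaf two links_less True by fastforce
    then have "edge_count G 1 2 = 0" by (simp only: edge_count_links card.empty)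
    moreover have "{(a, b) \<in> R. link_degree R a = 2 \<and> link_degree R b = 2 \<or>
        link_degree R a = 2 \<and> link_degree R b = 2} = {}"
      using two links_less by fastforce
    then have "edge_count G 2 2 = 0" by (simp only: edge_count_links card.empty)
    ultimately show ?thesis using bal(4) one True by (simp add: F1_iff[OF chem] order_eq)
  qed
qed

end

section \<open>Both families occur at every admissible order and size\<close>

abbreviation spine :: "nat \<Rightarrow> (nat \<times> nat) set" where
  "spine c \<equiv> links id Suc (c - 1)"

abbreviation closing_link :: "nat \<Rightarrow> (nat \<times> nat) set" where
  "closing_link c \<equiv> links (\<lambda>_. 0) (\<lambda>_. c - 1) 1"

abbreviation chords :: "nat \<Rightarrow> nat \<Rightarrow> (nat \<times> nat) set" where
  "chords s k \<equiv> links id (\<lambda>i. i + s) k"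

abbreviation pendants :: "nat \<Rightarrow> (nat \<Rightarrow> nat) \<Rightarrow> nat \<Rightarrow> (nat \<times> nat) set" where
  "pendants c f p \<equiv> links f (\<lambda>i. c + i) p"

lemma card_spine: "card (spine c) = c - 1"
  and card_closing_link: "card (closing_link c) = 1"
  and card_chords: "card (chords s k) = k"
  and card_pendants: "card (pendants c f p) = p"
  by (rule card_links; simp add: inj_on_def)+

lemma in_spine_iff: "(a, b) \<in> spine c \<longleftrightarrow> b = Suc a \<and> b < c"
  by (auto simp: in_links_iff)

lemma spine_degree: "link_degree (spine c) v = of_bool (Suc v < c) + of_bool (0 < v \<and> v < c)"
proof -
  have "v \<in> Suc ` {..<c - 1} \<longleftrightarrow> 0 < v \<and> v < c"
    by (cases v) auto
  moreover have "v \<in> id ` {..<c - 1} \<longleftrightarrow> Suc v < c" by auto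
  ultimately show ?thesis by (subst link_degree_links) auto
qed

lemma closing_link_degree:
  "2 \<le> c \<Longrightarrow> link_degree (closing_link c) v = of_bool (v = 0) + of_bool (v = c - 1)"
  by (subst link_degree_links) (auto simp: lessThan_Suc)

lemma chords_degree:
  "0 < s \<Longrightarrow> link_degree (chords s k) v = of_bool (v < k) + of_bool (s \<le> v \<and> v < s + k)"
proof -
  assume s: "0 < s"
  have "v \<in> (\<lambda>i. i + s) ` {..<k} \<longleftrightarrow> s \<le> v \<and> v < s + k"
    by (auto intro!: image_eqI[of _ _ "v - s"])
  then show ?thesis using s by (subst link_degree_links) (auto simp: inj_on_def)
qed

lemma pendants_degree:
  assumes "inj_on f {..<p}" "\<forall>i<p. f i < c"
  shows "link_degree (pendants c f p) v
    = of_bool (v \<in> f ` {..<p}) + of_bool (c \<le> v \<and> v < c + p)"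
proof -
  have "v \<in> (\<lambda>i. c + i) ` {..<p} \<longleftrightarrow> c \<le> v \<and> v < c + p"
    by (auto intro!: image_eqI[of _ _ "v - c"])
  then show ?thesis
    using assms by (subst link_degree_links) (auto simp: inj_on_def trans_less_add1)
qed

text \<open>
  A caterpillar: a path whose inner vertices all carry a pendant vertex, except that vertex 2 is
  skipped when \<open>n\<close> is odd. Both neighbours of vertex 2 on the path are inner vertices, because then the
  path has at least five vertices.
\<close>

lemma ex_F1_tree:
  fixes h :: "nat \<Rightarrow> 'a"
  assumes h: "inj_on h {..<n}" and n: "7 \<le> n" "n = m + 1"
  shows "\<exists>H \<in> F1. graph_order (H :: 'a ugraph) = n \<and> graph_size H = m"
proof -
  define c p where "c = n div 2 + 1 + n mod 2" and "p = n div 2 - 1"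
  define d where "d = n mod 2"
  have d: "d = 0 \<and> even n \<or> d = 1 \<and> odd n" unfolding d_def by presburger
  define f where "f = (\<lambda>i::nat. if i = 0 then 1 else i + 1 + d)"
  define R where "R = spine c \<union> pendants c f p"
  have half: "n = 2 * (n div 2) + n mod 2" "n mod 2 \<le> 1" by simp_all
  have np: "n = c + p" and c: "c = p + 2 + d" "2 \<le> p"
    unfolding c_def p_def d_def using n(1) half by linarith+
  have f_inj: "inj_on f {..<p}" by (auto simp: f_def inj_on_def split: if_splits)
  have f_less: "f i < c - 1" if "i < p" for i using that c by (simp add: f_def)
  have f_less_c: "\<forall>i<p. f i < c" using f_less less_imp_diff_less by fastforce
  have f_img: "v \<in> f ` {..<p} \<longleftrightarrow> v = 1 \<or> 1 + d < v \<and> v < c - 1" for v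
  proof
    assume "v \<in> f ` {..<p}"
    then show "v = 1 \<or> 1 + d < v \<and> v < c - 1" using c by (auto simp: f_def split: if_splits)
  next
    assume "v = 1 \<or> 1 + d < v \<and> v < c - 1"
    then consider "v = 1" | "1 + d < v" "v < c - 1" by blast
    then show "v \<in> f ` {..<p}"
    proof cases
      case 1
      then show ?thesis using c by (intro image_eqI[of _ _ 0]) (simp_all add: f_def)
    next
      case 2
      then show ?thesis using c by (intro image_eqI[of _ _ "v - 1 - d"]) (simp_all add: f_def)
    qed
  qed
  have disj: "spine c \<inter> pendants c f p = {}" by (auto simp: links_def)
  have deg: "link_degree R v = (if v = 0 \<or> c - 1 \<le> v then 1 else if v = 2 \<and> odd n then 2 else 3)"
    if "v < n" for v
  proof -
    have v: "v < c + p" using that np by simp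
    have "link_degree R v = of_bool (Suc v < c) + of_bool (0 < v \<and> v < c)
        + (of_bool (v = 1 \<or> 1 + d < v \<and> v < c - 1) + of_bool (c \<le> v \<and> v < c + p))"
      unfolding R_def link_degree_Un[OF finite_links finite_links disj] spine_degree
        pendants_degree[OF f_inj f_less_c] f_img by (rule refl)
    also have "\<dots> = (if v = 0 \<or> c - 1 \<le> v then 1 else if v = 2 \<and> odd n then 2 else 3)"
      using d
    proof (elim disjE conjE)
      assume "d = 0" "even n"
      then show ?thesis using v c by auto
    next
      assume "d = 1" "odd n"
      then show ?thesis using v c by auto
    qed
    finally show ?thesis .
  qed
  have R_iff: "(a, b) \<in> R \<longleftrightarrow> b = Suc a \<and> b < c \<or> (\<exists>i<p. a = f i \<and> b = c + i)" for a b
    by (auto simp: R_def in_links_iff)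
  interpret labelled h n R
  proof
    show "i < j \<and> j < n" if "(i, j) \<in> R" for i j
      using that np f_less_c by (auto simp: R_iff intro: trans_less_add1)
  qed (rule h)
  have "card R = card (spine c) + card (pendants c f p)"
    unfolding R_def using disj by (intro card_Un_disjoint) auto
  also have "\<dots> = m" unfolding card_spine card_pendants using n(2) np c by linarith
  finally have m: "card R = m" .
  have chem: "chemical_graph G"
  proof (rule chemical)
    show "\<exists>i. (i, j) \<in> R" if "0 < j" "j < n" for j
    proof (cases "j < c")
      case True
      then show ?thesis using that by (intro exI[of _ "j - 1"]) (auto simp: R_iff)
    next
      case False
      then have "j - c < p" "j = c + (j - c)" using that np by simp_all
      then have "(f (j - c), j) \<in> R" unfolding R_iff by blast
      then show ?thesis by blast
    qed
  qed (use n m deg in auto)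
  have "G \<in> F1"
  proof (rule in_F1[OF chem, of 2])
    show "2 < n" using n by simp
    show "link_degree R v = 2 \<longleftrightarrow> odd n \<and> v = 2" if "v < n" for v
      using deg[OF that] n c np by auto
    fix a b assume ab: "(a, b) \<in> R" and odd: "odd n"
    have c5: "5 \<le> c" using odd d c by auto
    have f_ne: "f i \<noteq> 2" for i using odd d by (auto simp: f_def)
    from ab consider "b = Suc a" "b < c" | i where "a = f i" "b = c + i" by (auto simp: R_iff)
    then show "\<not> (a = 2 \<and> link_degree R b = 1) \<and> \<not> (b = 2 \<and> link_degree R a = 1)"
    proof cases
      case 1
      have "link_degree R 1 = 3" "link_degree R 3 = 3"
        using deg[of 1] deg[of 3] c5 np by simp_all
      then show ?thesis using 1 by (auto simp: numeral_2_eq_2 numeral_3_eq_3)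
    next
      case 2
      then show ?thesis using f_ne c5 by simp
    qed
  qed
  then show ?thesis using order_eq size_eq m by blast
qed

text \<open>
  A cycle on \<open>c\<close> vertices with \<open>k\<close> chords \<open>i, i + k + 1\<close>; the shift \<open>k + 1\<close> instead of \<open>k\<close> keeps the
  chords different from the edges of the cycle even for \<open>k = 1\<close>. The chords use the vertices
  \<open>0, ..., 2 k\<close> except \<open>k\<close>. All other vertices of the cycle receive a pendant vertex, except that the
  last one is left with degree 2 when \<open>n\<close> is odd.
\<close>

lemma ex_F1_cyclic:
  fixes h :: "nat \<Rightarrow> 'a"
  assumes h: "inj_on h {..<n}" and n: "7 \<le> n" "m = n + k" "2 * m + 3 \<le> 3 * n"
  shows "\<exists>H \<in> F1. graph_order (H :: 'a ugraph) = n \<and> graph_size H = m"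
proof -
  define c p where "c = n div 2 + n mod 2 + k" and "p = n div 2 - k"
  define d where "d = n mod 2"
  have d: "d = 0 \<and> even n \<or> d = 1 \<and> odd n" unfolding d_def by presburger
  define f where "f = (\<lambda>i::nat. if i = 0 then k else 2 * k + i)"
  define R where "R = (spine c \<union> closing_link c) \<union> (chords (k + 1) k \<union> pendants c f p)"
  have half: "n = 2 * (n div 2) + n mod 2" by simp
  have parity: "n mod 2 = 0 \<or> n mod 2 = 1" by linarith
  have np: "n = c + p" and c: "c = 2 * k + p + d" "1 \<le> p" "4 \<le> c" "2 * k + 2 \<le> c"
    unfolding c_def p_def d_def using n half parity by (elim disjE; linarith)+
  have f_inj: "inj_on f {..<p}" by (auto simp: f_def inj_on_def split: if_splits)
  have f_less: "\<forall>i<p. f i < c" using c by (simp add: f_def)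
  have f_img: "v \<in> f ` {..<p} \<longleftrightarrow> v = k \<or> 2 * k < v \<and> v < 2 * k + p" for v
  proof
    assume "v \<in> f ` {..<p}"
    then show "v = k \<or> 2 * k < v \<and> v < 2 * k + p" using c by (auto simp: f_def split: if_splits)
  next
    assume "v = k \<or> 2 * k < v \<and> v < 2 * k + p"
    then consider "v = k" | "2 * k < v" "v < 2 * k + p" by blast
    then show "v \<in> f ` {..<p}"
    proof cases
      case 1
      then show ?thesis using c by (intro image_eqI[of _ _ 0]) (simp_all add: f_def)
    next
      case 2
      then show ?thesis by (intro image_eqI[of _ _ "v - 2 * k"]) (simp_all add: f_def)
    qed
  qed
  have c2: "2 \<le> c" and zero_less_k1: "0 < k + 1" using c by simp_all
  have disj: "spine c \<inter> closing_link c = {}" "chords (k + 1) k \<inter> pendants c f p = {}"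
    "(spine c \<union> closing_link c) \<inter> (chords (k + 1) k \<union> pendants c f p) = {}"
    using c f_less by (auto simp: links_def)
  have deg: "link_degree R v = (if c \<le> v then 1 else if v = c - 1 \<and> odd n then 2 else 3)"
    if "v < n" for v
  proof -
    have v: "v < c + p" using that np by simp
    have "link_degree R v = (of_bool (Suc v < c) + of_bool (0 < v \<and> v < c)
          + (of_bool (v = 0) + of_bool (v = c - 1)))
        + (of_bool (v < k) + of_bool (k + 1 \<le> v \<and> v < k + 1 + k)
          + (of_bool (v = k \<or> 2 * k < v \<and> v < 2 * k + p) + of_bool (c \<le> v \<and> v < c + p)))"
      unfolding R_def link_degree_Un[OF finite_UnI[OF finite_links finite_links]
          finite_UnI[OF finite_links finite_links] disj(3)]
        link_degree_Un[OF finite_links finite_links disj(1)]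
        link_degree_Un[OF finite_links finite_links disj(2)]
        spine_degree closing_link_degree[OF c2] chords_degree[OF zero_less_k1]
        pendants_degree[OF f_inj f_less] f_img by (rule refl)
    also have "\<dots> = (if c \<le> v then 1 else if v = c - 1 \<and> odd n then 2 else 3)"
      using d
    proof (elim disjE conjE)
      assume "d = 0" "even n"
      then show ?thesis using v c by auto
    next
      assume "d = 1" "odd n"
      then show ?thesis using v c by auto
    qed
    finally show ?thesis .
  qed
  have R_iff: "(a, b) \<in> R \<longleftrightarrow> b = Suc a \<and> b < c \<or> a = 0 \<and> b = c - 1 \<or>
      a < k \<and> b = a + (k + 1) \<or> (\<exists>i<p. a = f i \<and> b = c + i)" for a b
    by (auto simp: R_def in_links_iff)
  interpret labelled h n R
  proof
    show "i < j \<and> j < n" if "(i, j) \<in> R" for i j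
      using that np c f_less by (auto simp: R_iff intro: trans_less_add1)
  qed (rule h)
  have "card R = (card (spine c) + card (closing_link c))
      + (card (chords (k + 1) k) + card (pendants c f p))"
    unfolding R_def using disj by (simp add: card_Un_disjoint)
  also have "\<dots> = m"
    unfolding card_spine card_closing_link card_chords card_pendants using n(2) np c by linarith
  finally have m: "card R = m" .
  have chem: "chemical_graph G"
  proof (rule chemical)
    show "\<exists>i. (i, j) \<in> R" if "0 < j" "j < n" for j
    proof (cases "j < c")
      case True
      then show ?thesis using that by (intro exI[of _ "j - 1"]) (auto simp: R_iff)
    next
      case False
      then have "j - c < p" "j = c + (j - c)" using that np by simp_all
      then have "(f (j - c), j) \<in> R" unfolding R_iff by blast
      then show ?thesis by blast
    qed
  qed (use n m deg in auto)
  have "G \<in> F1"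
  proof (rule in_F1[OF chem, of "c - 1"])
    show "c - 1 < n" using c np by simp
    show "link_degree R v = 2 \<longleftrightarrow> odd n \<and> v = c - 1" if "v < n" for v
      using deg[OF that] c by auto
    fix a b assume ab: "(a, b) \<in> R" and odd: "odd n"
    have cp: "c - 1 = 2 * k + p" using odd d c by auto
    have f_ne: "f i \<noteq> c - 1" if "i < p" for i
      using that cp c by (simp add: f_def)
    show "\<not> (a = c - 1 \<and> link_degree R b = 1) \<and> \<not> (b = c - 1 \<and> link_degree R a = 1)"
    proof (cases "b < c")
      case True
      then have "a < b" using links_less[OF ab] by blast
      then show ?thesis using deg[of a] deg[of b] np True by auto
    next
      case False
      then obtain i where "i < p" "a = f i" using ab c by (auto simp: R_iff)
      then show ?thesis using f_ne False c(3) by auto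
    qed
  qed
  then show ?thesis using order_eq size_eq m by blast
qed

lemma ex_F2_path:
  fixes h :: "nat \<Rightarrow> 'a"
  assumes h: "inj_on h {..<n}" and n: "7 \<le> n" "n = m + 1"
  shows "\<exists>H \<in> F2. graph_order (H :: 'a ugraph) = n \<and> graph_size H = m"
proof -
  interpret labelled h n "spine n"
  proof
    show "i < j \<and> j < n" if "(i, j) \<in> spine n" for i j
      using that unfolding in_spine_iff by simp
  qed (rule h)
  have m: "card (spine n) = m" unfolding card_spine using n by simp
  have deg: "link_degree (spine n) v \<le> 2" for v unfolding spine_degree by simp
  have chem: "chemical_graph G"
  proof (rule chemical)
    show "\<exists>i. (i, j) \<in> spine n" if "0 < j" "j < n" for j
      using that unfolding in_spine_iff by (intro exI[of _ "j - 1"]) simp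
    show "link_degree (spine n) v \<le> 3" for v using deg[of v] by simp
  qed (use n m in auto)
  note bal = chemical_balance[OF chem]
  have "link_degree (spine n) v \<noteq> 3" for v using deg[of v] by linarith
  then have "{v. v < n \<and> link_degree (spine n) v = 3} = {}" by blast
  then have N3: "card (degree_class G 3) = 0" by (simp only: card_degree_class card.empty)
  have sz: "graph_size G = m" using size_eq m by (rule trans)
  then have "edge_count G 1 3 = 0" "edge_count G 2 3 = 0" "edge_count G 1 2 = 2"
    using bal N3 n(2) order_eq by linarith+
  moreover have "m < n" "m \<le> n" using n(2) by simp_all
  ultimately have "G \<in> F2" unfolding F2_iff[OF chem] order_eq sz by (simp only: if_True simp_thms)
  then show ?thesis using order_eq size_eq m by blast
qed

text \<open>
  A Hamiltonian cycle with \<open>k\<close> chords. For \<open>k \<ge> 2\<close> the chords \<open>i, i + k\<close> use an initial segment of the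
  cycle, so that only the two edges leaving this segment are 23-edges. For \<open>k = 1\<close> the
  shift 1 would repeat an edge of the cycle, and the chord \<open>0, 2\<close> makes the two vertices of degree 3
  adjacent.
\<close>

lemma ex_F2_cyclic:
  fixes h :: "nat \<Rightarrow> 'a"
  assumes h: "inj_on h {..<n}" and n: "7 \<le> n" "m = n + k" "2 * m + 3 \<le> 3 * n"
  shows "\<exists>H \<in> F2. graph_order (H :: 'a ugraph) = n \<and> graph_size H = m"
proof -
  \<comment> \<open>For \<open>k = 0\<close> there are no chords; the value 1 only keeps \<open>s\<close> positive.\<close>
  define s where "s = (if k = 1 then 2 else if k = 0 then 1 else k)"
  define R where "R = (spine n \<union> closing_link n) \<union> chords s k"
  have s: "0 < s" "k \<noteq> 0 \<Longrightarrow> 2 \<le> s" "k \<noteq> 0 \<Longrightarrow> s + k + 2 \<le> n" "k \<le> s"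
    using n by (auto simp: s_def)
  have n2: "2 \<le> n" using n by simp
  have disj: "spine n \<inter> closing_link n = {}" "(spine n \<union> closing_link n) \<inter> chords s k = {}"
    using n s by (auto simp: links_def)
  have deg: "link_degree R v = (if v < k \<or> s \<le> v \<and> v < s + k then 3 else 2)" if "v < n" for v
  proof -
    have "link_degree R v = of_bool (Suc v < n) + of_bool (0 < v \<and> v < n)
          + (of_bool (v = 0) + of_bool (v = n - 1))
        + (of_bool (v < k) + of_bool (s \<le> v \<and> v < s + k))"
      unfolding R_def link_degree_Un[OF finite_UnI[OF finite_links finite_links] finite_links disj(2)]
        link_degree_Un[OF finite_links finite_links disj(1)]
        spine_degree closing_link_degree[OF n2] chords_degree[OF s(1)] by (rule refl)
    also have "\<dots> = (if v < k \<or> s \<le> v \<and> v < s + k then 3 else 2)"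
      using that s(4) n by auto
    finally show ?thesis .
  qed
  have R_iff: "(a, b) \<in> R \<longleftrightarrow> b = Suc a \<and> b < n \<or> a = 0 \<and> b = n - 1 \<or> a < k \<and> b = a + s" for a b
    using n by (auto simp: R_def in_links_iff)
  interpret labelled h n R
  proof
    show "i < j \<and> j < n" if "(i, j) \<in> R" for i j
      using that n s by (auto simp: R_iff)
  qed (rule h)
  have "card R = (card (spine n) + card (closing_link n)) + card (chords s k)"
    unfolding R_def using disj by (simp add: card_Un_disjoint)
  also have "\<dots> = m" unfolding card_spine card_closing_link card_chords using n by linarith
  finally have m: "card R = m" .
  have chem: "chemical_graph G"
  proof (rule chemical)
    show "\<exists>i. (i, j) \<in> R" if "0 < j" "j < n" for j
      using that by (intro exI[of _ "j - 1"]) (simp add: R_iff)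
  qed (use n m deg in auto)
  note bal = chemical_balance[OF chem]
  have "{v. v < n \<and> link_degree R v = 1} = {}" using deg by auto
  then have N1: "card (degree_class G 1) = 0" by (simp only: card_degree_class card.empty)
  then have N3: "card (degree_class G 3) = 2 * k"
    using bal n m by (simp add: order_eq size_eq)
  have x: "edge_count G 1 2 = 0" "edge_count G 1 3 = 0" using bal(3) N1 by simp_all
  consider "k = 0" | "k = 1" | "2 \<le> k" by linarith
  then have "edge_count G 2 3 = (if k = 0 then 0 else if k = 1 then 4 else 2)"
  proof cases
    case 1
    then show ?thesis using bal(5) N3 by simp
  next
    case 2
    have "edge_count G 3 3 \<le> 1" using edge_count_33_le[OF chem] N3 2 by (simp add: choose_two)
    moreover have "{h 0, h 2} \<in> edges G"
      using 2 by (force simp: labelled_graph_def R_iff s_def)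
    then have "edge_count G 3 3 \<noteq> 0"
      using deg[of 0] deg[of 2] n(1) 2 vdegree_eq[of 0] vdegree_eq[of 2]
      unfolding edge_count_eq_0_iff[OF simple] s_def by auto
    ultimately show ?thesis using bal(5) N3 2 x by simp
  next
    case 3
    have sk: "s = k" using 3 by (simp add: s_def)
    have deg': "link_degree R v = (if v < 2 * k then 3 else 2)" if "v < n" for v
      using deg[OF that] unfolding sk by auto
    have "a = 2 * k - 1 \<and> b = 2 * k \<or> a = 0 \<and> b = n - 1"
      if ab: "(a, b) \<in> R" and ne: "link_degree R a \<noteq> link_degree R b" for a b
    proof -
      have "a < b" "b < n" using links_less[OF ab] by simp_all
      then have "a < 2 * k" "2 * k \<le> b" using ne deg'[of a] deg'[of b] by (auto split: if_splits)
      then show ?thesis using ab unfolding R_iff sk by auto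
    qed
    then have "{(a, b) \<in> R. link_degree R a = 2 \<and> link_degree R b = 3 \<or>
        link_degree R a = 3 \<and> link_degree R b = 2} \<subseteq> {(2 * k - 1, 2 * k), (0, n - 1)}"
      by force
    then have "edge_count G 2 3 \<le> card {(2 * k - 1, 2 * k), (0, n - 1)}"
      unfolding edge_count_links by (rule card_mono[rotated]) simp
    also have "\<dots> \<le> 2" by (simp add: card_insert_if)
    finally have "edge_count G 2 3 \<le> 2" .
    moreover have "edge_count G 2 3 \<noteq> 0"
    proof
      assume "edge_count G 2 3 = 0"
      then have "card (degree_class G 2) = 0 \<or> card (degree_class G 3) = 0"
        using no_23_edge_imp_empty_class[OF chem] by auto
      then show False using bal(1) N1 N3 n 3 by (simp add: order_eq)
    qed
    moreover have "edge_count G 2 3 = 2 * (card (degree_class G 2) - edge_count G 2 2)"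
      using bal(4) x by linarith
    then have "edge_count G 2 3 \<noteq> 1" by auto
    ultimately have "edge_count G 2 3 = 2" by linarith
    then show ?thesis using 3 by simp
  qed
  then have "G \<in> F2" using x n m by (simp add: F2_iff[OF chem] order_eq size_eq)
  then show ?thesis using order_eq size_eq m by blast
qed

lemma both_families_occur:
  assumes G: "chemical_graph (G :: 'a ugraph)"
  shows "\<exists>H \<in> F1. graph_order (H :: 'a ugraph) = graph_order G \<and> graph_size H = graph_size G"
    and "\<exists>H \<in> F2. graph_order (H :: 'a ugraph) = graph_order G \<and> graph_size H = graph_size G"
proof -
  note n = chemical_order[OF G]
  have "finite (verts G)" using chemical_simple[OF G] by (simp add: simple_graph_def)
  then obtain h where "bij_betw h {0..<card (verts G)} (verts G)" using ex_bij_betw_nat_finite by blast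
  then have h: "inj_on h {..<graph_order G}"
    by (simp add: bij_betw_def graph_order_def atLeast0LessThan)
  have "graph_order G \<le> graph_size G + 1"
    by (intro connected_order_le_size chemical_simple chemical_connected G)
  then have cyclomatic: "graph_order G = graph_size G + 1 \<or>
      graph_size G = graph_order G + (graph_size G - graph_order G)" by linarith
  then show "\<exists>H \<in> F1. graph_order (H :: 'a ugraph) = graph_order G \<and> graph_size H = graph_size G"
  proof (elim disjE)
    assume "graph_order G = graph_size G + 1"
    then show ?thesis by (rule ex_F1_tree[OF h n])
  next
    assume "graph_size G = graph_order G + (graph_size G - graph_order G)"
    then show ?thesis by (rule ex_F1_cyclic[OF h n _ chemical_size[OF G]])
  qed
  from cyclomatic
  show "\<exists>H \<in> F2. graph_order (H :: 'a ugraph) = graph_order G \<and> graph_size H = graph_size G"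
  proof (elim disjE)
    assume "graph_order G = graph_size G + 1"
    then show ?thesis by (rule ex_F2_path[OF h n])
  next
    assume "graph_size G = graph_order G + (graph_size G - graph_order G)"
    then show ?thesis by (rule ex_F2_cyclic[OF h n _ chemical_size[OF G]])
  qed
qed

section \<open>Extremal graphs\<close>

lemma order_size_via_edge_counts:
  assumes "chemical_graph G"
  shows "real (graph_order G) = (9 * real (edge_count G 1 2) + 8 * real (edge_count G 1 3)
      + 6 * real (edge_count G 2 2) + 5 * real (edge_count G 2 3) + 4 * real (edge_count G 3 3)) / 6"
    and "real (graph_size G) = real (edge_count G 1 2) + real (edge_count G 1 3)
      + real (edge_count G 2 2) + real (edge_count G 2 3) + real (edge_count G 3 3)"
proof -
  note bal = chemical_balance[OF assms]
  have "6 * graph_order G = 9 * edge_count G 1 2 + 8 * edge_count G 1 3 + 6 * edge_count G 2 2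
      + 5 * edge_count G 2 3 + 4 * edge_count G 3 3"
    using bal by linarith
  from arg_cong[OF this, of real]
  show "real (graph_order G) = (9 * real (edge_count G 1 2) + 8 * real (edge_count G 1 3)
      + 6 * real (edge_count G 2 2) + 5 * real (edge_count G 2 3) + 4 * real (edge_count G 3 3)) / 6"
    by simp
  show "real (graph_size G) = real (edge_count G 1 2) + real (edge_count G 1 3)
      + real (edge_count G 2 2) + real (edge_count G 2 3) + real (edge_count G 3 3)"
    unfolding bal(2) by simp
qed

lemma index_via_F2_cost:
  assumes "chemical_graph G"
  shows "degree_based_index c G =
    c 2 2 * (3 * real (graph_order G) - 2 * real (graph_size G))
    + 3 * c 3 3 * (real (graph_size G) - real (graph_order G))
    + cost_12_13_23 (excess12 c) (excess13 c) (excess23 c) G"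
  unfolding degree_based_index_def cost_12_13_23_def excess12_def excess13_def excess23_def
    order_size_via_edge_counts[OF assms]
  by (simp add: field_simps)

lemma index_via_F1_cost:
  assumes "chemical_graph G"
  shows "degree_based_index c G =
    c 1 3 * (3 * real (graph_order G) - 2 * real (graph_size G)) / 2
    + c 3 3 * (4 * real (graph_size G) - 3 * real (graph_order G)) / 2
    - cost_12_22_23 (5 / 4 * excess13 c - excess12 c) (excess13 c / 2)
        (excess13 c / 4 - excess23 c) G"
  unfolding degree_based_index_def cost_12_22_23_def excess12_def excess13_def excess23_def
    order_size_via_edge_counts[OF assms]
  by (simp add: field_simps)

lemma cost_12_13_23_scale:
  "s * cost_12_13_23 p q r G = cost_12_13_23 (s * p) (s * q) (s * r) G"
  by (simp add: cost_12_13_23_def algebra_simps)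

lemma cost_12_22_23_scale:
  "s * cost_12_22_23 a b c G = cost_12_22_23 (s * a) (s * b) (s * c) G"
  by (simp add: cost_12_22_23_def algebra_simps)

text \<open>
  Elimination of \<open>x\<^sub>1\<^sub>3\<close> and \<open>x\<^sub>3\<^sub>3\<close> turns the cost bound for \<open>F1\<close> into an upper bound for \<open>s\<close> times the
  index, because the cost enters negatively. Uniqueness of the optimal edge counts makes the
  comparison strict outside the family.
\<close>

lemma F1_index_compare:
  fixes G H :: "'a ugraph"
  assumes ord: "excess_ordered s c" and H: "H \<in> F1" and G: "chemical_graph G"
    and same: "graph_order H = graph_order G" "graph_size H = graph_size G"
  shows "G \<in> F1 \<Longrightarrow> s * degree_based_index c G = s * degree_based_index c H"
    and "G \<notin> F1 \<Longrightarrow> s * degree_based_index c G < s * degree_based_index c H"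
proof -
  have chemH: "chemical_graph H" using H by (simp add: F1_def)
  let ?cost = "\<lambda>K. s * cost_12_22_23 (5 / 4 * excess13 c - excess12 c) (excess13 c / 2)
        (excess13 c / 4 - excess23 c) (K :: 'a ugraph)"
  have diff: "s * degree_based_index c H - s * degree_based_index c G = ?cost G - ?cost H"
    unfolding index_via_F1_cost[OF G] index_via_F1_cost[OF chemH] same by (simp add: algebra_simps)
  show "s * degree_based_index c G = s * degree_based_index c H" if "G \<in> F1"
  proof -
    have "?cost H = ?cost G" unfolding F1_cost_eq[OF H] F1_cost_eq[OF that] same by (rule refl)
    then show ?thesis using diff by linarith
  qed
  show "s * degree_based_index c G < s * degree_based_index c H" if "G \<notin> F1"
  proof -
    have "?cost H < ?cost G"
      unfolding cost_12_22_23_scale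
      by (rule F1_cost_less[OF _ _ _ H G that same(1)])
        (use ord in \<open>simp_all add: excess_ordered_def algebra_simps\<close>)
    then show ?thesis using diff by linarith
  qed
qed

lemma F2_index_compare:
  fixes G H :: "'a ugraph"
  assumes ord: "excess_ordered s c" and H: "H \<in> F2" and G: "chemical_graph G"
    and same: "graph_order H = graph_order G" "graph_size H = graph_size G"
  shows "G \<in> F2 \<Longrightarrow> s * degree_based_index c G = s * degree_based_index c H"
    and "G \<notin> F2 \<Longrightarrow> s * degree_based_index c H < s * degree_based_index c G"
proof -
  have chemH: "chemical_graph H" using H by (simp add: F2_def)
  let ?cost = "\<lambda>K. s * cost_12_13_23 (excess12 c) (excess13 c) (excess23 c) (K :: 'a ugraph)"
  have diff: "s * degree_based_index c H - s * degree_based_index c G = ?cost H - ?cost G"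
    unfolding index_via_F2_cost[OF G] index_via_F2_cost[OF chemH] same by (simp add: algebra_simps)
  show "s * degree_based_index c G = s * degree_based_index c H" if "G \<in> F2"
  proof -
    have "?cost H = ?cost G" unfolding F2_cost_eq[OF H] F2_cost_eq[OF that] same by (rule refl)
    then show ?thesis using diff by linarith
  qed
  show "s * degree_based_index c H < s * degree_based_index c G" if "G \<notin> F2"
  proof -
    have "?cost H < ?cost G"
      unfolding cost_12_13_23_scale
      by (rule F2_cost_less[OF _ _ _ _ H G that same])
        (use ord in \<open>simp_all add: excess_ordered_def\<close>)
    then show ?thesis using diff by linarith
  qed
qed

lemma extremal_iff_scaled:
  fixes f :: "'a ugraph \<Rightarrow> real"
  assumes "s = 1 \<or> s = -1"
  shows "extremal f G \<longleftrightarrow> chemical_graph G \<and>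
     ((\<forall>H. chemical_graph H \<and> graph_order H = graph_order G \<and> graph_size H = graph_size G \<longrightarrow> s * f H \<le> s * f G) \<or>
      (\<forall>H. chemical_graph H \<and> graph_order H = graph_order G \<and> graph_size H = graph_size G \<longrightarrow> s * f G \<le> s * f H))"
  using assms unfolding extremal_def by (elim disjE) auto

text \<open>
  An extremal graph is at least as good as the members of \<open>F1\<close>, or of \<open>F2\<close>, with its order and size;
  since these exist, strictness of the comparison puts it into the family.
\<close>

lemma extremal_iff_F1_or_F2:
  fixes G :: "'a ugraph"
  assumes s: "s = 1 \<or> s = -1" and ord: "excess_ordered s c"
  shows "extremal (degree_based_index c) G \<longleftrightarrow> G \<in> F1 \<union> F2"
proof
  assume ext: "extremal (degree_based_index c) G"
  then have G: "chemical_graph G" by (simp add: extremal_def)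
  obtain H1 :: "'a ugraph" where H1: "H1 \<in> F1" "graph_order H1 = graph_order G" "graph_size H1 = graph_size G"
    using both_families_occur(1)[OF G] by blast
  obtain H2 :: "'a ugraph" where H2: "H2 \<in> F2" "graph_order H2 = graph_order G" "graph_size H2 = graph_size G"
    using both_families_occur(2)[OF G] by blast
  have chem: "chemical_graph H1" "chemical_graph H2" using H1(1) H2(1) by (simp_all add: F1_def F2_def)
  have "s * degree_based_index c H1 \<le> s * degree_based_index c G \<or>
      s * degree_based_index c G \<le> s * degree_based_index c H2"
    using ext[unfolded extremal_iff_scaled[OF s]] chem H1 H2 by blast
  then show "G \<in> F1 \<union> F2"
    using F1_index_compare(2)[OF ord H1(1) G H1(2,3)] F2_index_compare(2)[OF ord H2(1) G H2(2,3)]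
    by (meson UnI1 UnI2 not_less)
next
  assume "G \<in> F1 \<union> F2"
  then consider "G \<in> F1" | "G \<in> F2" by blast
  then show "extremal (degree_based_index c) G"
  proof cases
    case 1
    have "s * degree_based_index c H \<le> s * degree_based_index c G"
      if "chemical_graph H" "graph_order H = graph_order G" "graph_size H = graph_size G" for H :: "'a ugraph"
      using F1_index_compare[OF ord 1 that(1) that(2,3)[symmetric]] by (metis less_imp_le order_refl)
    moreover have "chemical_graph G" using 1 by (simp add: F1_def)
    ultimately show ?thesis unfolding extremal_iff_scaled[OF s] by blast
  next
    case 2
    have "s * degree_based_index c G \<le> s * degree_based_index c H"
      if "chemical_graph H" "graph_order H = graph_order G" "graph_size H = graph_size G" for H :: "'a ugraph"
      using F2_index_compare[OF ord 2 that(1) that(2,3)[symmetric]] by (metis less_imp_le order_refl)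
    moreover have "chemical_graph G" using 2 by (simp add: F2_def)
    ultimately show ?thesis unfolding extremal_iff_scaled[OF s] by blast
  qed
qed

theorem corollary7:
  fixes t :: topological_index
  shows "{G :: 'a ugraph. extremal (index_value t) G} = F1 \<union> F2"
proof -
  obtain s where "s = 1 \<or> s = -1" "excess_ordered s (\<lambda>i j. coefficient t (real i) (real j))"
    using index_excess_ordered by blast
  then have "extremal (index_value t) G \<longleftrightarrow> G \<in> F1 \<union> F2" for G :: "'a ugraph"
    unfolding index_value_def by (rule extremal_iff_F1_or_F2)
  then show ?thesis by blast
qed

end
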